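(* Let $\alpha>0$ and $n\in\{0,1,2,\ldots\}$. The auxiliary quantities $R_n=R_n(t)$ and $r_n=r_n(t)$ associated with the weight $w(x,t)=(1-x^2)^\alpha e^{-t/(1-x^2)}$ on $[-1,1]$ satisfy, for $t>0$, the second-order nonlinear ordinary differential equations (prime $=d/dt$) $$\begin{aligned} &8t^2R_n(2n+1+2\alpha+R_n)R_n''-4t^2(4n+2+4\alpha+3R_n)(R_n')^2+8tR_n(2n+1+2\alpha+R_n)R_n'\\ &-R_n^5-2(2n+1+2\alpha)R_n^4-4\left[(n+\alpha)(n+1+\alpha)-t(t-2\alpha)\right]R_n^3+16t(2n+1+2\alpha)(t-\alpha)R_n^2\\ &+4t(2n+1+2\alpha)^2(5t-2\alpha)R_n+8t^2(2n+1+2\alpha)^3=0, \end{aligned}$$ $$\begin{aligned} &4t^2r_n(2t+r_n)r_n''-4t^2(t+r_n)(r_n')^2+4t\,r_n^2\,r_n'-r_n^5-(2n+2\alpha+5t)r_n^4-8t(n+\alpha+t)r_n^3\\ &-4t\left[(t+\alpha)^2+n(2t+\alpha)-1\right]r_n^2+4n^2t^2\,r_n+4n^2t^3=0. \end{aligned}$$ Moreover, the function $$W_n(t):=\frac{2n+1+2\alpha+R_n(t)}{2n+1+2\alpha}$$ satisfies the Painlevé V equation $$W_n''=\frac{(3W_n-1)(W_n')^2}{2W_n(W_n-1)}-\frac{W_n'}{t}+\frac{(W_n-1)^2}{t^2}\left(\mu_1W_n+\frac{\mu_2}{W_n}\right)+\frac{\mu_3W_n}{t}+\frac{\mu_4W_n(W_n+1)}{W_n-1},$$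 with $$\mu_1=\frac{(2n+1+2\alpha)^2}{8},\qquad\mu_2=-\frac18,\qquad\mu_3=\alpha,\qquad\mu_4=-\frac12.$$
   Context: Fix $\alpha>0$. For $t>0$ let $w(x,t):=(1-x^2)^\alpha e^{-t/(1-x^2)}$, $x\in[-1,1]$, and let $P_n(x,t)$, $n=0,1,2,\ldots$, be the monic polynomials of degree $n$ with $\int_{-1}^1 P_m(x,t)P_n(x,t) w(x,t)\,dx=h_n(t)\delta_{mn}$. The auxiliary quantities are $$R_n(t):=\frac{2t}{h_n(t)}\int_{-1}^1\frac{1}{1-y^2}P_n^2(y,t)w(y,t)\,dy,\qquad r_n(t):=\frac{2t}{h_{n-1}(t)}\int_{-1}^1\frac{y}{1-y^2}P_n(y,t)P_{n-1}(y,t)w(y,t)\,dy,$$ with $r_0(t)=0$. *)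

theory Defs
  imports "HOL-Analysis.Analysis" "HOL-Computational_Algebra.Polynomial"
begin

(* At x = -1 and x = 1 the library conventions 1 / 0 = 0 and 0 powr a = 0 give the
   weight the value 0, which is its limit there for t > 0. *)
definition weight :: "real \<Rightarrow> real \<Rightarrow> real \<Rightarrow> real" where
  "weight \<alpha> t x = (1 - x\<^sup>2) powr \<alpha> * exp (- t / (1 - x\<^sup>2))"

(* P n t is the polynomial P_n(., t) and h n t its squared norm; nothing is required for t \<le> 0. *)
definition monic_orthogonal ::
  "real \<Rightarrow> (nat \<Rightarrow> real \<Rightarrow> real poly) \<Rightarrow> (nat \<Rightarrow> real \<Rightarrow> real) \<Rightarrow> bool" where
  "monic_orthogonal \<alpha> P h \<longleftrightarrow>
     (\<forall>t>0. (\<forall>n. degree (P n t) = n \<and> lead_coeff (P n t) = 1) \<and>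
            (\<forall>m n. integral {-1..1} (\<lambda>x. poly (P m t) x * poly (P n t) x * weight \<alpha> t x)
                     = (if m = n then h n t else 0)))"

(* The integrands below take the value 0 at the two endpoints, again their limit for t > 0. *)
definition aux_R ::
  "real \<Rightarrow> (nat \<Rightarrow> real \<Rightarrow> real poly) \<Rightarrow> (nat \<Rightarrow> real \<Rightarrow> real) \<Rightarrow> nat \<Rightarrow> real \<Rightarrow> real" where
  "aux_R \<alpha> P h n t = 2 * t / h n t *
     integral {-1..1} (\<lambda>y. 1 / (1 - y\<^sup>2) * (poly (P n t) y)\<^sup>2 * weight \<alpha> t y)"

definition aux_r ::
  "real \<Rightarrow> (nat \<Rightarrow> real \<Rightarrow> real poly) \<Rightarrow> (nat \<Rightarrow> real \<Rightarrow> real) \<Rightarrow> nat \<Rightarrow> real \<Rightarrow> real" where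
  "aux_r \<alpha> P h n t = (if n = 0 then 0 else 2 * t / h (n - 1) t *
     integral {-1..1} (\<lambda>y. y / (1 - y\<^sup>2) * poly (P n t) y * poly (P (n - 1) t) y * weight \<alpha> t y))"

(* Explicit, because deriv is an unspecified value where a derivative does not exist. *)
definition twice_differentiable_pos :: "(real \<Rightarrow> real) \<Rightarrow> bool" where
  "twice_differentiable_pos f \<longleftrightarrow>
     (\<forall>t>0. f field_differentiable at t \<and> deriv f field_differentiable at t)"

(* W t \<noteq> 0 and W t \<noteq> 1 make the divisions in the equation genuine. *)
definition satisfies_painleve_V ::
  "real \<Rightarrow> real \<Rightarrow> real \<Rightarrow> real \<Rightarrow> (real \<Rightarrow> real) \<Rightarrow> bool" where
  "satisfies_painleve_V \<mu>1 \<mu>2 \<mu>3 \<mu>4 W \<longleftrightarrow>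
     twice_differentiable_pos W \<and>
     (\<forall>t>0. W t \<noteq> 0 \<and> W t \<noteq> 1 \<and>
        deriv (deriv W) t =
          (3 * W t - 1) * (deriv W t)\<^sup>2 / (2 * W t * (W t - 1))
          - deriv W t / t
          + (W t - 1)\<^sup>2 / t\<^sup>2 * (\<mu>1 * W t + \<mu>2 / W t)
          + \<mu>3 * W t / t
          + \<mu>4 * W t * (W t + 1) / (W t - 1))"

end

theory Submission
  imports Defs
begin

text \<open>
  Write \<open>s = 1 / (1 - y\<^sup>2)\<close>, \<open>m = n - 1\<close>, and let \<open>I\<^sub>k\<close>, \<open>K\<^sub>k\<close> be the integrals of
  \<open>s P\<^sub>k\<^sup>2 w\<close> and \<open>s\<^sup>2 P\<^sub>k\<^sup>2 w\<close>, and \<open>J\<close>, \<open>J2\<close> those of \<open>s y P\<^sub>n P\<^sub>m w\<close> and \<open>s\<^sup>2 y P\<^sub>n P\<^sub>m w\<close>.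
  A polynomial of definite parity that vanishes at \<open>1\<close> is divisible by \<open>1 - y\<^sup>2\<close>, which cancels a
  factor \<open>s\<close>, after which orthogonality evaluates the integral. Applied to combinations of
  \<open>P\<^sub>n\<close> and \<open>y P\<^sub>m\<close>, this gives \<open>J (J + h\<^sub>m) = I\<^sub>n I\<^sub>m\<close>, one relation among the second moments, and
  the expression of \<open>(1 - y\<^sup>2) dP\<^sub>k/dt\<close> through \<open>P\<^sub>n\<close> and \<open>P\<^sub>m\<close> for \<open>k = n, m\<close>. Integration by parts reduces
  \<open>K\<close> and \<open>J2\<close> to \<open>I\<close>, \<open>J\<close> and \<open>h\<close>. Hence \<open>R\<close> and \<open>r\<close> satisfy the closed first-order system
  \<open>2t R' = R\<^sup>2 + (c + 1)R - 2(r + t)(c + R)\<close> and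
  \<open>2t R r' = R(2r + (c - 1)r + 2nt - r(r + 2t)) - 2c r(r + 2t)\<close> with \<open>c = 2n + 1 + 2\<alpha>\<close>.
  Eliminating either unknown yields the two second-order equations, and \<open>W = 1 + R/c\<close> turns the one
  for \<open>R\<close> into Painleve V.
\<close>

subsection \<open>Moments of the singular weight\<close>

text \<open>The exponential series has nonnegative terms, so \<open>exp (c / u)\<close> dominates
  its \<open>m\<close>-th term alone. Hence no pole at \<open>u = 0\<close> can compete with
  \<open>exp (- c / u)\<close>.\<close>

lemma inverse_power_exp_le:
  fixes u c :: real
  assumes "0 < u" "0 < c"
  shows "(1 / u) ^ m * exp (- c / u) \<le> fact m / c ^ m"
proof -
  have "(c / u) ^ m /\<^sub>R fact m \<le> exp (c / u)"
    unfolding exp_def using assms sum_le_suminf[OF summable_exp_generic, of "{m}" "c / u"] by simp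
  then have "c ^ m * (1 / u) ^ m \<le> fact m * exp (c / u)"
    using assms by (simp add: pos_divide_le_eq power_divide field_simps)
  then show ?thesis
    using assms by (simp add: field_simps exp_minus)
qed

lemma weight_nonneg: "0 \<le> weight \<alpha> t y"
  by (simp add: weight_def)

lemma weight_pos: "y\<^sup>2 < 1 \<Longrightarrow> 0 < weight \<alpha> t y"
  by (simp add: weight_def)

lemma weight_minus: "weight \<alpha> t (- y) = weight \<alpha> t y"
  by (simp add: weight_def)

lemma weight_boundary: "y\<^sup>2 = 1 \<Longrightarrow> weight \<alpha> t y = 0"
  by (simp add: weight_def)

lemma weight_has_derivative:
  assumes "y\<^sup>2 < 1"
  shows "(weight \<alpha> t has_real_derivative
    - (2 * \<alpha> * y * (1 / (1 - y\<^sup>2)) + 2 * t * y * (1 / (1 - y\<^sup>2))\<^sup>2) * weight \<alpha> t y) (at y)"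
proof -
  have u: "0 < 1 - y\<^sup>2" using assms by simp
  have *: "((\<lambda>y. (1 - y\<^sup>2) powr \<alpha> * exp (- t / (1 - y\<^sup>2))) has_real_derivative
     (\<alpha> * (1 - y\<^sup>2) powr (\<alpha> - 1) * (- (2 * y))) * exp (- t / (1 - y\<^sup>2)) +
     (1 - y\<^sup>2) powr \<alpha> * (exp (- t / (1 - y\<^sup>2)) * - (2 * t * y * (1 / (1 - y\<^sup>2))\<^sup>2))) (at y)"
    using u by (auto intro!: derivative_eq_intros simp: power2_eq_square)
  have "(1 - y\<^sup>2) powr (\<alpha> - 1) = (1 - y\<^sup>2) powr \<alpha> * (1 / (1 - y\<^sup>2))"
    using u by (simp add: powr_diff)
  then show ?thesis
    using * unfolding weight_def[abs_def] by (simp add: algebra_simps)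
qed

lemma weight_has_derivative_time:
  "((\<lambda>t. weight \<alpha> t y) has_real_derivative - (1 / (1 - y\<^sup>2)) * weight \<alpha> t y) (at t within S)"
proof -
  have "((\<lambda>t. - t / (1 - y\<^sup>2)) has_real_derivative - 1 / (1 - y\<^sup>2)) (at t within S)"
    by (intro DERIV_cdivide DERIV_minus DERIV_ident)
  from DERIV_cmult[OF DERIV_chain2[OF DERIV_exp this], of "(1 - y\<^sup>2) powr \<alpha>"]
  show ?thesis unfolding weight_def by (simp add: mult_ac)
qed

text \<open>The exponential absorbs one more pole than is present, which leaves a factor vanishing
  at the endpoints. The bound is uniform in \<open>t\<close> above \<open>c\<close>.\<close>

lemma weight_le:
  assumes "0 < \<alpha>" "0 < c" "c \<le> t" "y\<^sup>2 \<le> 1"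
  shows "(1 / (1 - y\<^sup>2)) ^ j * weight \<alpha> t y \<le> fact (Suc j) / c ^ Suc j * (1 - y\<^sup>2)"
proof (cases "y\<^sup>2 = 1")
  case True
  then show ?thesis by (simp add: weight_def)
next
  case False
  define u where "u = 1 - y\<^sup>2"
  have u: "0 < u" "u \<le> 1" using False assms by (auto simp: u_def)
  have "(1 / u) ^ j * (u powr \<alpha> * exp (- t / u)) \<le> (1 / u) ^ j * (1 * exp (- c / u))"
    using u assms by (intro mult_mono powr_le1) (auto simp: divide_right_mono)
  also have "\<dots> = u * ((1 / u) ^ Suc j * exp (- c / u))"
    using u by (simp add: field_simps)
  also have "\<dots> \<le> u * (fact (Suc j) / c ^ Suc j)"
    using u assms by (intro mult_left_mono inverse_power_exp_le) auto
  finally show ?thesis by (simp add: weight_def u_def mult.commute)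
qed

text \<open>Joint continuity up to the endpoints is what the Leibniz rule requires. There the
  function is squeezed between 0 and the bound of \<open>weight_le\<close>; elsewhere the formula
  itself is continuous.\<close>

lemma continuous_on_weight:
  assumes "0 < \<alpha>" "0 < c"
  shows "continuous_on ({c..} \<times> {-1..1}) (\<lambda>(t, y). (1 / (1 - y\<^sup>2)) ^ j * weight \<alpha> t y)"
    (is "continuous_on ?S ?g")
proof (unfold continuous_on_eq_continuous_within, rule ballI)
  fix z :: "real \<times> real"
  assume "z \<in> ?S"
  then obtain t y where z: "z = (t, y)" and "t \<in> {c..}" "y \<in> {-1..1}" by auto
  then have t: "c \<le> t" and y: "y\<^sup>2 \<le> 1" by (auto simp: abs_square_le_1)
  show "continuous (at z within ?S) ?g"
  proof (cases "y\<^sup>2 = 1")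
    case True
    have "(?g \<longlongrightarrow> 0) (at (t, y) within ?S)"
    proof (rule tendsto_sandwich[where f="\<lambda>_. 0"])
      show "\<forall>\<^sub>F z in at (t, y) within ?S. 0 \<le> ?g z"
        unfolding eventually_at_topological
        by (intro exI[of _ UNIV]) (auto intro!: mult_nonneg_nonneg weight_nonneg simp: abs_square_le_1)
      show "\<forall>\<^sub>F z in at (t, y) within ?S. ?g z \<le> fact (Suc j) / c ^ Suc j * (1 - (snd z)\<^sup>2)"
        unfolding eventually_at_topological
      proof (intro exI[of _ UNIV] conjI ballI impI)
        fix z :: "real \<times> real" assume "z \<in> ?S"
        then have "c \<le> fst z" "(snd z)\<^sup>2 \<le> 1" by (auto simp: abs_square_le_1)
        from weight_le[OF assms this, of j]
        show "?g z \<le> fact (Suc j) / c ^ Suc j * (1 - (snd z)\<^sup>2)" by (simp add: case_prod_beta)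
      qed auto
      have "((\<lambda>z. fact (Suc j) / c ^ Suc j * (1 - (snd z)\<^sup>2)) \<longlongrightarrow>
             fact (Suc j) / c ^ Suc j * (1 - (snd (t, y))\<^sup>2)) (at (t, y) within ?S)"
        by (intro tendsto_intros)
      then show "((\<lambda>z. fact (Suc j) / c ^ Suc j * (1 - (snd z)\<^sup>2)) \<longlongrightarrow> 0) (at (t, y) within ?S)"
        using True by simp
    qed auto
    then show ?thesis
      using True by (simp add: z continuous_within weight_boundary)
  next
    case False
    then show ?thesis
      unfolding z weight_def case_prod_beta continuous_within
      by (intro tendsto_intros) auto
  qed
qed

text \<open>The order \<open>j\<close> of the pole is kept apart from the polynomial: cancelling a
  factor \<open>1 - y\<^sup>2\<close> lowers \<open>j\<close>, and differentiating the weight in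
  time raises it.\<close>

definition moment :: "real \<Rightarrow> nat \<Rightarrow> real \<Rightarrow> real poly \<Rightarrow> real" where
  "moment \<alpha> j t p = integral {-1..1} (\<lambda>y. (1 / (1 - y\<^sup>2)) ^ j * poly p y * weight \<alpha> t y)"

lemma moment_continuous:
  assumes "0 < \<alpha>" "0 < t"
  shows "continuous_on {-1..1} (\<lambda>y. (1 / (1 - y\<^sup>2)) ^ j * poly p y * weight \<alpha> t y)"
proof -
  have "continuous_on {-1..1} (\<lambda>y. (\<lambda>(t, y). (1 / (1 - y\<^sup>2)) ^ j * weight \<alpha> t y) (t, y))"
    by (rule continuous_on_compose2[OF continuous_on_weight[OF assms]])
       (auto intro!: continuous_intros)
  then have "continuous_on {-1..1} (\<lambda>y. poly p y * ((1 / (1 - y\<^sup>2)) ^ j * weight \<alpha> t y))"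
    by (intro continuous_on_mult[OF continuous_on_poly]) simp_all
  then show ?thesis by (simp add: mult_ac)
qed

lemma moment_integrable:
  assumes "0 < \<alpha>" "0 < t"
  shows "(\<lambda>y. (1 / (1 - y\<^sup>2)) ^ j * poly p y * weight \<alpha> t y) integrable_on {-1..1}"
  by (intro integrable_continuous_real moment_continuous assms)

lemma moment_add:
  assumes "0 < \<alpha>" "0 < t"
  shows "moment \<alpha> j t (p + q) = moment \<alpha> j t p + moment \<alpha> j t q"
  using integral_add[OF moment_integrable[OF assms, of j p] moment_integrable[OF assms, of j q]]
  by (simp add: moment_def algebra_simps)

lemma moment_smult: "moment \<alpha> j t (smult k p) = k * moment \<alpha> j t p"
  unfolding moment_def
  by (subst integral_mult_right[symmetric]) (auto simp: algebra_simps)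

lemma moment_0: "moment \<alpha> j t 0 = 0"
  by (simp add: moment_def)

lemma moment_diff:
  assumes "0 < \<alpha>" "0 < t"
  shows "moment \<alpha> j t (p - q) = moment \<alpha> j t p - moment \<alpha> j t q"
  using moment_add[OF assms, of j p "smult (-1) q"] moment_smult[of \<alpha> j t "-1" q]
  by simp

lemma moment_minus: "moment \<alpha> j t (- p) = - moment \<alpha> j t p"
  using moment_smult[of \<alpha> j t "-1" p] by simp

lemma moment_sum:
  assumes "0 < \<alpha>" "0 < t"
  shows "moment \<alpha> j t (\<Sum>k\<in>A. f k) = (\<Sum>k\<in>A. moment \<alpha> j t (f k))"
  by (induction A rule: infinite_finite_induct) (simp_all add: moment_0 moment_add assms)

lemma moment_reduce: "moment \<alpha> (Suc j) t ([:1, 0, -1:] * p) = moment \<alpha> j t p"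
  unfolding moment_def
proof (rule integral_cong)
  fix y :: real
  \<comment> \<open>At the endpoints \<open>1 / 0 = 0\<close> spoils the cancellation, but there the
    weight makes both sides 0.\<close>
  show "(1 / (1 - y\<^sup>2)) ^ Suc j * poly ([:1, 0, -1:] * p) y * weight \<alpha> t y =
        (1 / (1 - y\<^sup>2)) ^ j * poly p y * weight \<alpha> t y"
    by (cases "y\<^sup>2 = 1") (simp add: weight_boundary, simp add: field_simps power2_eq_square)
qed

lemma moment_reflect:
  assumes "\<And>y. poly q y = poly p (- y)"
  shows "moment \<alpha> j t q = moment \<alpha> j t p"
proof -
  have "integral {- 1.. - (- 1)} (\<lambda>y. (1 / (1 - (- y)\<^sup>2)) ^ j * poly p (- y) * weight \<alpha> t (- y)) =
        integral {- 1..1} (\<lambda>y. (1 / (1 - y\<^sup>2)) ^ j * poly p y * weight \<alpha> t y)"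
    by (rule Henstock_Kurzweil_Integration.integral_reflect_real)
  then show ?thesis by (simp add: moment_def weight_minus assms)
qed

text \<open>The integrand is continuous and nonnegative; since \<open>p\<close> has finitely many
  roots, it is nonzero at some interior point.\<close>

lemma moment_square_pos:
  assumes "0 < \<alpha>" "0 < t" "p \<noteq> 0"
  shows "0 < moment \<alpha> j t (p * p)"
proof -
  let ?f = "\<lambda>y. (1 / (1 - y\<^sup>2)) ^ j * poly (p * p) y * weight \<alpha> t y"
  have nn: "0 \<le> ?f y" if "y \<in> {-1..1}" for y
    using that by (intro mult_nonneg_nonneg weight_nonneg) (auto simp: abs_square_le_1)
  have "infinite ({-1<..<1::real} - {x. poly p x = 0})"
    using poly_roots_finite[OF \<open>p \<noteq> 0\<close>] by (intro Diff_infinite_finite) auto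
  then obtain y where "y \<in> {-1<..<1}" "poly p y \<noteq> 0"
    using infinite_imp_nonempty by blast
  then have y: "y\<^sup>2 < 1" "y \<in> {-1..1}" "poly p y \<noteq> 0" by (auto simp: abs_square_less_1)
  then have "?f y \<noteq> 0" using weight_pos[of y \<alpha> t] by auto
  then have "moment \<alpha> j t (p * p) \<noteq> 0"
    unfolding moment_def using y(2) nn
    by (subst integral_eq_0_iff[OF moment_continuous[OF assms(1,2)]]) (simp, simp, blast)
  moreover have "0 \<le> moment \<alpha> j t (p * p)"
    unfolding moment_def by (intro integral_nonneg moment_integrable assms nn)
  ultimately show ?thesis by simp
qed

lemma moment_has_derivative:
  assumes "0 < \<alpha>" "0 < t"
  shows "((\<lambda>t. moment \<alpha> j t p) has_real_derivative - moment \<alpha> (Suc j) t p) (at t)"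
proof -
  let ?f = "\<lambda>t y. (1 / (1 - y\<^sup>2)) ^ j * poly p y * weight \<alpha> t y"
  let ?g = "\<lambda>t y. - ((1 / (1 - y\<^sup>2)) ^ Suc j * poly p y * weight \<alpha> t y)"
  \<comment> \<open>The half-line from \<open>t / 2\<close> contains a neighbourhood of
    \<open>t\<close> and stays away from time 0, so the joint continuity is available on it.\<close>
  have "((\<lambda>t. integral (cbox (-1) 1) (?f t)) has_field_derivative integral (cbox (-1) 1) (?g t))
        (at t within {t / 2..})"
  proof (rule leibniz_rule_field_derivative)
    fix x y :: real
    show "((\<lambda>x. ?f x y) has_field_derivative ?g x y) (at x within {t / 2..})"
      by (rule DERIV_cong[OF DERIV_cmult[OF weight_has_derivative_time]]) simp
  next
    show "?f x integrable_on cbox (-1) 1" if "x \<in> {t / 2..}" for x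
      using moment_integrable[of \<alpha> x] assms that by simp
  next
    have "continuous_on ({t / 2..} \<times> {-1..1})
            (\<lambda>z. - (poly p (snd z) * ((\<lambda>(t, y). (1 / (1 - y\<^sup>2)) ^ Suc j * weight \<alpha> t y) z)))"
      using assms
      by (intro continuous_on_minus continuous_on_mult continuous_on_weight)
         (auto intro!: continuous_intros)
    then show "continuous_on ({t / 2..} \<times> cbox (-1) 1) (\<lambda>(t, y). ?g t y)"
      by (simp add: case_prod_beta mult_ac)
  qed (use assms in auto)
  moreover have "t \<in> interior {t / 2..}" using assms by simp
  then have "at t within {t / 2..} = at t" by (rule at_within_interior)
  ultimately show ?thesis
    by (simp only: moment_def integral_neg cbox_interval)
qed

text \<open>Integration by parts. The boundary terms vanish with the weight, and the right-hand side
  collects the two terms of its logarithmic derivative.\<close>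

lemma moment_pderiv:
  assumes "0 < \<alpha>" "0 < t"
  shows "moment \<alpha> 0 t (pderiv p) =
         2 * \<alpha> * moment \<alpha> 1 t ([:0, 1:] * p) + 2 * t * moment \<alpha> 2 t ([:0, 1:] * p)"
proof -
  let ?s = "\<lambda>y. 1 / (1 - y\<^sup>2) :: real"
  let ?f = "\<lambda>y. ?s y ^ 0 * poly (pderiv p) y * weight \<alpha> t y -
    (2 * \<alpha> * (?s y ^ 1 * poly ([:0, 1:] * p) y * weight \<alpha> t y) +
     2 * t * (?s y ^ 2 * poly ([:0, 1:] * p) y * weight \<alpha> t y))"
  have "(?f has_integral poly p 1 * weight \<alpha> t 1 - poly p (-1) * weight \<alpha> t (-1)) {-1..1}"
  proof (rule fundamental_theorem_of_calculus_interior)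
    show "continuous_on {-1..1} (\<lambda>y. poly p y * weight \<alpha> t y)"
      using moment_continuous[OF assms, of 0 p] by simp
    fix y :: real assume "y \<in> {-1<..<1}"
    then have "y\<^sup>2 < 1" by (auto simp: abs_square_less_1)
    have "((\<lambda>y. poly p y * weight \<alpha> t y) has_real_derivative ?f y) (at y)"
      by (rule DERIV_cong[OF DERIV_mult[OF poly_DERIV weight_has_derivative[OF \<open>y\<^sup>2 < 1\<close>]]])
         (simp add: algebra_simps)
    then show "((\<lambda>y. poly p y * weight \<alpha> t y) has_vector_derivative ?f y) (at y)"
      by (simp add: has_real_derivative_iff_has_vector_derivative)
  qed simp
  moreover have "(?f has_integral moment \<alpha> 0 t (pderiv p) -
      (2 * \<alpha> * moment \<alpha> 1 t ([:0, 1:] * p) + 2 * t * moment \<alpha> 2 t ([:0, 1:] * p))) {-1..1}"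
    unfolding moment_def
    by (intro has_integral_diff has_integral_add has_integral_mult_right integrable_integral
        moment_integrable assms)
  ultimately show ?thesis
    by (auto dest: has_integral_unique simp: weight_boundary)
qed

subsection \<open>Parity and orthogonality\<close>

definition X :: "real poly" where "X = [:0, 1:]"

lemma poly_X [simp]: "poly X y = y"
  by (simp add: X_def)

lemma coeff_X_mult [simp]: "coeff (X * q) 0 = 0" "coeff (X * q) (Suc k) = coeff q k"
  by (simp_all add: X_def)

lemma pderiv_X [simp]: "pderiv X = 1"
  by (simp add: X_def pderiv_pCons)

lemma moment_reduce_X: "moment \<alpha> (Suc j) t ((1 - X * X) * p) = moment \<alpha> j t p"
proof -
  have "1 - X * X = [:1, 0, -1:]" by (simp add: X_def one_pCons)
  then show ?thesis using moment_reduce by simp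
qed

lemma moment_pderiv_X:
  assumes "0 < \<alpha>" "0 < t"
  shows "moment \<alpha> 0 t (pderiv p) = 2 * \<alpha> * moment \<alpha> 1 t (X * p) + 2 * t * moment \<alpha> 2 t (X * p)"
  using moment_pderiv[OF assms] unfolding X_def .

definition has_parity :: "nat \<Rightarrow> real poly \<Rightarrow> bool" where
  "has_parity n q \<longleftrightarrow> (\<forall>x. poly q (- x) = (- 1) ^ n * poly q x)"

lemma has_parity_add_even [simp]: "has_parity (Suc (Suc n)) q \<longleftrightarrow> has_parity n q"
  by (simp add: has_parity_def)

lemma has_parity_diff: "has_parity n p \<Longrightarrow> has_parity n q \<Longrightarrow> has_parity n (p - q)"
  by (simp add: has_parity_def algebra_simps)

lemma has_parity_smult: "has_parity n p \<Longrightarrow> has_parity n (smult c p)"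
  by (simp add: has_parity_def)

lemma has_parity_X_mult: "has_parity n p \<Longrightarrow> has_parity (Suc n) (X * p)"
  by (simp add: has_parity_def)

lemma has_parity_iff_pcompose: "has_parity n q \<longleftrightarrow> pcompose q [:0, -1:] = smult ((- 1) ^ n) q"
  unfolding poly_eq_poly_eq_iff[symmetric] has_parity_def by (auto simp: fun_eq_iff poly_pcompose)

text \<open>Reflection multiplies the coefficient of degree \<open>k\<close> by
  \<open>(- 1) ^ k\<close>, so a coefficient in a degree of the wrong parity equals its own
  negative.\<close>

lemma has_parity_coeff: "has_parity n q \<Longrightarrow> coeff q (Suc n) = 0"
  using coeff_pcompose_linear[of q "-1" "Suc n"]
  by (auto simp: has_parity_iff_pcompose)

text \<open>A polynomial of definite parity that vanishes at \<open>1\<close> also vanishes at \<open>- 1\<close>.\<close>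

lemma divide_one_minus_X2:
  assumes "has_parity n q" "poly q 1 = 0" "\<And>k. n < k \<Longrightarrow> coeff q k = 0"
  obtains q1 where "q = (1 - X * X) * q1" "has_parity n q1" "\<And>k. n < k + 2 \<Longrightarrow> coeff q1 k = 0"
    "coeff (X * (X * q1)) n = - coeff q n"
proof -
  have "poly q (- 1) = 0"
    using assms(1,2) by (simp add: has_parity_def)
  from assms(2) obtain a where a: "q = [:-1, 1:] * a"
    by (auto simp: poly_eq_0_iff_dvd dvd_def)
  with \<open>poly q (- 1) = 0\<close> have "poly a (- 1) = 0" by simp
  then obtain b where b: "a = [:1, 1:] * b"
    by (auto simp: poly_eq_0_iff_dvd dvd_def)
  have q: "q = (1 - X * X) * (- b)"
    unfolding a b by (simp add: X_def algebra_simps)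
  define q1 where "q1 = - b"
  have nz: "1 - X * X \<noteq> 0" by (simp add: X_def one_pCons)
  have qq: "q = (1 - X * X) * q1" by (simp add: q q1_def)
  \<comment> \<open>The degree drops by two. Writing \<open>n < k + 2\<close> avoids the truncated
    \<open>n - 2\<close>: for \<open>n\<close> equal to 0 or 1 it forces
    \<open>q1 = 0\<close>.\<close>
  have co: "coeff q1 k = 0" if "n < k + 2" for k
  proof (rule ccontr)
    assume "coeff q1 k \<noteq> 0"
    then have "k \<le> degree q1" "q1 \<noteq> 0" by (auto simp: le_degree)
    moreover have "degree (1 - X * X) = 2"
      by (simp add: X_def one_pCons)
    ultimately have "degree q = 2 + degree q1" "q \<noteq> 0"
      using nz by (simp_all add: qq degree_mult_eq)
    with \<open>k \<le> degree q1\<close> that have "n < degree q" by simp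
    from assms(3)[OF this] \<open>q \<noteq> 0\<close> show False by simp
  qed
  have "(1 - X * X) * pcompose q1 [:0, -1:] = pcompose q [:0, -1:]"
    unfolding poly_eq_poly_eq_iff[symmetric] by (auto simp: fun_eq_iff poly_pcompose qq)
  also have "\<dots> = (1 - X * X) * smult ((- 1) ^ n) q1"
    using assms(1) by (simp add: has_parity_iff_pcompose qq)
  finally have "has_parity n q1"
    using nz unfolding has_parity_iff_pcompose by (metis mult_cancel_left)
  \<comment> \<open>Compare degree \<open>n\<close> in \<open>q = q1 - X * X * q1\<close>, where
    \<open>q1\<close> itself has no such term. This tracks the leading coefficient for later use
    with orthogonality.\<close>
  moreover have "coeff (X * (X * q1)) n = - coeff q n"
    using co[of n] by (simp add: qq left_diff_distrib mult.assoc)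
  ultimately show ?thesis using that qq co by blast
qed

section \<open>Monic orthogonal polynomials at one fixed time: orthogonality, parity and
  recurrence\<close>

locale orth_polys =
  fixes \<alpha> t :: real and p :: "nat \<Rightarrow> real poly" and N :: "nat \<Rightarrow> real"
  assumes \<alpha>_pos: "0 < \<alpha>" and t_pos: "0 < t"
    and degree_p: "degree (p n) = n" and monic_p: "lead_coeff (p n) = 1"
    and orth: "moment \<alpha> 0 t (p m * p n) = (if m = n then N n else 0)"
begin

abbreviation "L j q \<equiv> moment \<alpha> j t q"

lemmas lin = moment_add[OF \<alpha>_pos t_pos] moment_diff[OF \<alpha>_pos t_pos] moment_smult moment_minus moment_0

lemma coeff_p_self [simp]: "coeff (p n) n = 1"
  using monic_p[of n] by (simp add: degree_p)

lemma coeff_p_above: "n < k \<Longrightarrow> coeff (p n) k = 0"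
  by (simp add: coeff_eq_0 degree_p)

lemma p_neq_0: "p n \<noteq> 0"
  using coeff_p_self[of n] by force

lemma N_pos: "0 < N n"
  using moment_square_pos[OF \<alpha>_pos t_pos p_neq_0, of 0 n] orth[of n n] by simp

text \<open>Induction on the degree bound: subtracting a multiple of \<open>p m\<close> removes the
  top term. Bounding the degree through vanishing coefficients lets the induction start at the zero
  polynomial.\<close>

lemma orth_lower:
  assumes "m \<le> n" "\<And>k. m \<le> k \<Longrightarrow> coeff q k = 0"
  shows "L 0 (p n * q) = 0"
  using assms
proof (induction m arbitrary: q)
  case 0
  then have "q = 0" by (simp add: poly_eq_iff)
  then show ?case by (simp add: lin)
next
  case (Suc m)
  let ?q = "q - smult (coeff q m) (p m)"
  have "L 0 (p n * ?q) = 0"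
  proof (rule Suc.IH)
    fix k assume "m \<le> k"
    then show "coeff ?q k = 0"
      using Suc.prems(2)[of k] by (cases "k = m") (auto simp: coeff_p_above)
  qed (use Suc.prems in simp)
  then show ?case
    using Suc.prems(1) by (simp add: right_diff_distrib lin orth)
qed

lemma orth_top:
  assumes "\<And>k. n < k \<Longrightarrow> coeff q k = 0"
  shows "L 0 (p n * q) = coeff q n * N n"
proof -
  have "L 0 (p n * (q - smult (coeff q n) (p n))) = 0"
  proof (rule orth_lower[OF order_refl])
    fix k assume "n \<le> k"
    then show "coeff (q - smult (coeff q n) (p n)) k = 0"
      using assms[of k] by (cases "k = n") (auto simp: coeff_p_above)
  qed
  then show ?thesis by (simp add: right_diff_distrib lin orth)
qed

lemma L_square_eq_0: "L 0 (q * q) = 0 \<Longrightarrow> q = 0"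
  using moment_square_pos[OF \<alpha>_pos t_pos, of q 0] by force

text \<open>Uniqueness: the reflected polynomial, with its sign corrected, is again monic and
  orthogonal to lower degrees because the weight is even. The difference \<open>d\<close> has lower
  degree, hence is orthogonal to itself.\<close>

lemma parity_p: "has_parity n (p n)"
proof -
  define q where "q = smult ((- 1) ^ n) (pcompose (p n) [:0, -1:])"
  define d where "d = q - p n"
  have cd: "coeff d k = 0" if "n \<le> k" for k
    using that by (cases "k = n")
      (auto simp: d_def q_def coeff_pcompose_linear coeff_p_above power_mult_distrib[symmetric])
  have "L 0 (p n * d) = 0"
    by (rule orth_lower[OF order_refl cd])
  moreover have "L 0 (q * d) = L 0 (p n * smult ((- 1) ^ n) (pcompose d [:0, -1:]))"
    by (rule moment_reflect) (simp add: q_def poly_pcompose)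
  moreover have "\<dots> = 0"
    by (rule orth_lower[OF order_refl]) (simp add: coeff_pcompose_linear cd)
  ultimately have "L 0 (d * d) = 0"
    by (simp add: d_def[of] left_diff_distrib lin)
  then have "pcompose (p n) [:0, -1:] = smult ((- 1) ^ n) (p n)"
    using L_square_eq_0[of d] smult_smult[of "(- 1) ^ n" "(- 1) ^ n" "pcompose (p n) [:0, -1:]"]
    by (simp add: d_def q_def power_mult_distrib[symmetric])
  then show ?thesis by (simp add: has_parity_iff_pcompose)
qed

lemma p_0: "p 0 = 1"
  using degree_p[of 0] coeff_p_self[of 0] by (metis degree_0_id of_nat_1 one_pCons)

lemma p_1: "p (Suc 0) = X"
proof (rule poly_eqI)
  fix k
  have "coeff (p (Suc 0)) 0 = 0"
    using parity_p[of "Suc 0"] by (simp add: has_parity_def poly_0_coeff_0[symmetric])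
      (metis add.inverse_neutral equal_neg_zero)
  then show "coeff (p (Suc 0)) k = coeff X k"
    by (cases k; cases "k - 1") (auto simp: X_def coeff_p_above)
qed

text \<open>The remainder \<open>v\<close> is shown to have degree below \<open>m\<close> and then
  to be orthogonal to itself. The recurrence serves to propagate differentiability in time from two
  degrees to the next.\<close>

lemma recurrence: "X * p (Suc m) = p (Suc (Suc m)) + smult (N (Suc m) / N m) (p m)"
proof -
  define v where "v = X * p (Suc m) - p (Suc (Suc m)) - smult (N (Suc m) / N m) (p m)"
  have par: "has_parity m v"
    unfolding v_def
    using has_parity_X_mult[OF parity_p[of "Suc m"]] parity_p[of "Suc (Suc m)"] parity_p[of m]
    by (intro has_parity_diff has_parity_smult) simp_all
  have above: "coeff v k = 0" if "m < k" for k
  proof -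
    \<comment> \<open>Degree \<open>Suc m\<close> is excluded by parity, degree
      \<open>Suc (Suc m)\<close> by cancellation of the leading terms.\<close>
    have "k = Suc m \<or> k = Suc (Suc m) \<or> (\<exists>j. k = Suc (Suc (Suc m + j)))"
      using that by presburger
    then show ?thesis
      using has_parity_coeff[OF par]
      by (elim disjE exE) (auto simp: v_def coeff_p_above)
  qed
  have 1: "L 0 (p m * v) = 0"
  proof -
    have "L 0 (p (Suc m) * (X * p m)) = N (Suc m)"
      using orth_top[of "Suc m" "X * p m"] coeff_p_above[of m]
      by (metis coeff_X_mult(2) coeff_p_self lambda_one Suc_lessE)
    then show ?thesis
      using N_pos[of m] orth[of m m] orth[of "m" "Suc (Suc m)"]
      by (simp add: v_def algebra_simps lin)
  qed
  have vv: "L 0 (p m * v) = coeff v m * N m"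
    by (rule orth_top) (rule above)
  then have "coeff v m = 0" using 1 N_pos[of m] by simp
  then have cv: "coeff v k = 0" if "m \<le> k" for k
    using that above by (cases "k = m") auto
  have "L 0 (p (Suc m) * (X * v)) = 0"
  proof (rule orth_lower[OF order_refl])
    fix k assume "Suc m \<le> k"
    then show "coeff (X * v) k = 0" using cv by (cases k) auto
  qed
  moreover have "L 0 (p (Suc (Suc m)) * v) = 0"
    by (rule orth_lower[of m]) (simp_all add: cv)
  ultimately have "L 0 ((X * p (Suc m) - p (Suc (Suc m)) - smult (N (Suc m) / N m) (p m)) * v) = 0"
    using 1 by (simp add: algebra_simps lin)
  then have "L 0 (v * v) = 0"
    by (simp only: v_def[symmetric])
  then have "v = 0" by (rule L_square_eq_0)
  then show ?thesis by (simp add: v_def algebra_simps)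
qed

subsection \<open>Identities at a fixed time\<close>

text \<open>Up to factors \<open>2 * t / N\<close>, \<open>I n\<close> is the auxiliary
  \<open>R\<close> of index \<open>n\<close> and \<open>J m\<close> is \<open>r\<close> of index
  \<open>Suc m\<close>. \<open>J\<close> and \<open>J2\<close> carry the lower of their two degrees,
  which avoids \<open>n - 1\<close>.\<close>

definition I :: "nat \<Rightarrow> real" where "I n = L 1 (p n * p n)"
definition K :: "nat \<Rightarrow> real" where "K n = L 2 (p n * p n)"
definition J :: "nat \<Rightarrow> real" where "J m = L 1 (X * (p (Suc m) * p m))"
definition J2 :: "nat \<Rightarrow> real" where "J2 m = L 2 (X * (p (Suc m) * p m))"

lemma I_pos: "0 < I n"
  unfolding I_def by (rule moment_square_pos[OF \<alpha>_pos t_pos p_neq_0])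

lemma L_reduce: "L (Suc j) ((1 - X * X) * q) = L j q"
  by (rule moment_reduce_X)

lemma L_reduce_left: "L (Suc j) (r * ((1 - X * X) * q)) = L j (r * q)"
  using L_reduce[of j "r * q"] by (simp add: mult_ac)

lemma L_XX: "L (Suc j) (X * (X * q)) = L (Suc j) q - L j q"
  using L_reduce[of j q] by (simp add: algebra_simps lin)

text \<open>The coefficient is that of \<open>q\<close> in degree \<open>m - 1\<close>, read off
  after multiplication by \<open>X * X\<close> so that it is 0 for \<open>m = 0\<close> and fits the
  output of \<open>divide_one_minus_X2\<close>.\<close>

lemma orth_X_top:
  assumes "\<And>k. Suc m < k + 2 \<Longrightarrow> coeff q k = 0"
  shows "L 0 (X * (p m * q)) = coeff (X * (X * q)) (Suc m) * N m"
proof -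
  have "coeff (X * q) k = 0" if "m < k" for k
    using that assms by (cases k) auto
  from orth_top[OF this] show ?thesis by (simp add: mult_ac)
qed

lemma coeff_XX_p: "m + 2 < k \<Longrightarrow> coeff (X * (X * p m)) k = 0"
  using coeff_p_above[of m "k - 2"]
  by (cases k; cases "k - 1") auto

lemma coeff_X_p: "m + 1 < k \<Longrightarrow> coeff (X * p m) k = 0"
  using coeff_p_above[of m "k - 1"]
  by (cases k) auto

text \<open>The coefficients are the endpoint values taken crosswise, so \<open>f m\<close> vanishes
  at 1; both of its terms have parity \<open>Suc m\<close>.\<close>

lemma lower_split:
  defines "f m \<equiv> smult (poly (p (Suc m)) 1) (X * p m) - smult (poly (p m) 1) (p (Suc m))"
  obtains q where "f m = (1 - X * X) * q" "has_parity (Suc m) q"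
    "\<And>k. Suc m < k + 2 \<Longrightarrow> coeff q k = 0"
proof (rule divide_one_minus_X2[of "Suc m" "f m"])
  show "has_parity (Suc m) (f m)"
    unfolding f_def by (intro has_parity_diff has_parity_smult has_parity_X_mult parity_p)
qed (use that in \<open>auto simp: f_def coeff_X_p coeff_p_above\<close>)

text \<open>The combination with values of the polynomials at the endpoint is divisible by \<open>1 - x\<^sup>2\<close>,
  which cancels the pole of the weight factor, so that orthogonality applies.\<close>

lemma endpoint_lower: "poly (p (Suc m)) 1 * J m = poly (p m) 1 * I (Suc m)"
proof -
  obtain q where q: "smult (poly (p (Suc m)) 1) (X * p m) - smult (poly (p m) 1) (p (Suc m)) =
      (1 - X * X) * q" "\<And>k. Suc m < k + 2 \<Longrightarrow> coeff q k = 0"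
    using lower_split[of m] by blast
  have "L 1 (p (Suc m) * ((1 - X * X) * q)) = 0"
    unfolding One_nat_def L_reduce_left
    by (rule orth_lower[of "Suc m"]) (use q(2) in simp_all)
  then show ?thesis
    unfolding q(1)[symmetric] I_def J_def by (simp add: algebra_simps lin)
qed

text \<open>Here the combination has degree \<open>m + 2\<close>, so the quotient \<open>q\<close>
  has degree \<open>m\<close> and leading coefficient \<open>poly (p m) 1\<close>. Its pairing with
  \<open>p m\<close> is the source of the extra \<open>N m\<close>.\<close>

lemma endpoint_upper: "poly (p m) 1 * (J m + N m) = poly (p (Suc m)) 1 * I m"
proof -
  let ?f = "smult (poly (p (Suc m)) 1) (p m) - smult (poly (p m) 1) (X * p (Suc m))"
  have "has_parity (Suc (Suc m)) ?f"
    by (intro has_parity_diff has_parity_smult has_parity_X_mult parity_p) (simp add: parity_p)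
  then obtain q where q: "?f = (1 - X * X) * q" "\<And>k. Suc (Suc m) < k + 2 \<Longrightarrow> coeff q k = 0"
     "coeff (X * (X * q)) (Suc (Suc m)) = - coeff ?f (Suc (Suc m))"
    by (rule divide_one_minus_X2) (auto simp: coeff_X_p coeff_p_above)
  have "L 1 (p m * ((1 - X * X) * q)) = poly (p m) 1 * N m"
    unfolding One_nat_def L_reduce_left
    by (subst orth_top) (use q(2,3) in \<open>simp_all add: coeff_p_above\<close>)
  then show ?thesis
    unfolding q(1)[symmetric] I_def J_def by (simp add: algebra_simps lin)
qed

text \<open>By \<open>endpoint_lower\<close> and the positivity of \<open>I\<close>, a zero at 1
  would descend to the preceding degree, and finally to \<open>p 0 = 1\<close>.\<close>

lemma p_at_1: "poly (p n) 1 \<noteq> 0"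
proof (induction n)
  case (Suc n)
  then show ?case using endpoint_lower[of n] I_pos[of "Suc n"] by force
qed (simp add: p_0)

text \<open>Multiply the two endpoint relations and cancel the endpoint values.\<close>

lemma I_J_quadratic: "J m * (J m + N m) = I (Suc m) * I m"
proof -
  have "poly (p (Suc m)) 1 * poly (p m) 1 * (J m * (J m + N m)) =
        poly (p (Suc m)) 1 * poly (p m) 1 * (I (Suc m) * I m)"
    using arg_cong2[OF endpoint_lower[of m] endpoint_upper[of m], of "(*)"] by (simp add: mult_ac)
  then show ?thesis using p_at_1 by simp
qed

text \<open>A double pole needs two divisions by \<open>1 - X * X\<close>. Pairing the result with
  \<open>p (Suc m)\<close> and with \<open>X * p m\<close> gives two relations with the same unknown
  constant \<open>l\<close>, which is then eliminated.\<close>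

lemma second_moments_proportional:
  "(I (Suc m) * J2 m - J m * K (Suc m)) * (J m + N m) =
   (I (Suc m) * (K m - I m) - J m * J2 m) * I (Suc m)"
proof -
  define a where "a = poly (p (Suc m)) 1"
  define b where "b = poly (p m) 1"
  obtain q where q: "smult a (X * p m) - smult b (p (Suc m)) = (1 - X * X) * q"
    "has_parity (Suc m) q" "\<And>k. Suc m < k + 2 \<Longrightarrow> coeff q k = 0"
    using lower_split[of m] unfolding a_def b_def by blast
  \<comment> \<open>Chosen so that \<open>q - smult l (p (Suc m))\<close> vanishes at 1 and can be
    divided again.\<close>
  define l where "l = poly q 1 / a"
  have a: "a \<noteq> 0" by (simp add: a_def p_at_1)
  have "has_parity (Suc m) (q - smult l (p (Suc m)))"
    by (intro has_parity_diff has_parity_smult parity_p q)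
  then obtain q2 where q2: "q - smult l (p (Suc m)) = (1 - X * X) * q2"
    "\<And>k. Suc m < k + 2 \<Longrightarrow> coeff q2 k = 0"
    "coeff (X * (X * q2)) (Suc m) = - coeff (q - smult l (p (Suc m))) (Suc m)"
    by (rule divide_one_minus_X2) (use q(3) a in \<open>auto simp: l_def coeff_p_above a_def\<close>)
  have qq: "q = smult l (p (Suc m)) + (1 - X * X) * q2"
    using q2(1) by (simp add: algebra_simps)
  have 1: "a * J2 m - b * K (Suc m) = l * I (Suc m)"
  proof -
    have "L 0 (p (Suc m) * q2) = 0"
      by (rule orth_lower[of "Suc m"]) (use q2(2) in simp_all)
    then have "L 1 (p (Suc m) * q) = l * I (Suc m)"
      using L_reduce_left[of 0 "p (Suc m)" q2] by (simp add: qq distrib_left lin I_def)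
    moreover have "L 2 (p (Suc m) * ((1 - X * X) * q)) = a * J2 m - b * K (Suc m)"
      unfolding q(1)[symmetric] J2_def K_def by (simp add: algebra_simps lin)
    ultimately show ?thesis
      using L_reduce_left[of 1 "p (Suc m)" q] by (simp add: numeral_2_eq_2)
  qed
  have 2: "a * (K m - I m) - b * J2 m = l * (J m + N m)"
  proof -
    have xx: "L 2 (X * (X * (p m * p m))) = K m - I m"
      using L_XX[of 1 "p m * p m"] by (simp add: K_def I_def numeral_2_eq_2)
    \<comment> \<open>Since \<open>q\<close> has no term of degree \<open>Suc m\<close>, the leading
      coefficient passed on to \<open>q2\<close> is exactly \<open>l\<close>.\<close>
    have "L 0 (X * (p m * q2)) = l * N m"
      by (subst orth_X_top) (use q2(2,3) q(3) in simp_all)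
    then have "L 1 (X * p m * q) = l * (J m + N m)"
      using L_reduce_left[of 0 "X * p m" q2] unfolding J_def
      by (simp add: qq distrib_left lin mult_ac)
    moreover have "L 2 (X * p m * ((1 - X * X) * q)) = a * (K m - I m) - b * J2 m"
      unfolding q(1)[symmetric] J2_def xx[symmetric] by (simp add: algebra_simps lin)
    ultimately show ?thesis
      using L_reduce_left[of 1 "X * p m" q] by (simp add: numeral_2_eq_2)
  qed
  \<comment> \<open>This trades \<open>b\<close> for \<open>a\<close>, so that only the nonzero
    factor \<open>a\<close> remains to be cancelled.\<close>
  have ab: "a * J m = b * I (Suc m)"
    using endpoint_lower[of m] by (simp add: a_def b_def)
  have "a * (I (Suc m) * J2 m - J m * K (Suc m)) = a * J2 m * I (Suc m) - (a * J m) * K (Suc m)"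
    by (simp add: algebra_simps)
  also have "\<dots> = l * I (Suc m) * I (Suc m)"
    unfolding ab 1[symmetric] by (simp add: algebra_simps)
  finally have 3: "a * (I (Suc m) * J2 m - J m * K (Suc m)) = l * I (Suc m) * I (Suc m)" .
  have "a * (I (Suc m) * (K m - I m) - J m * J2 m) = a * (K m - I m) * I (Suc m) - (a * J m) * J2 m"
    by (simp add: algebra_simps)
  also have "\<dots> = l * (J m + N m) * I (Suc m)"
    unfolding ab 2[symmetric] by (simp add: algebra_simps)
  finally have 4: "a * (I (Suc m) * (K m - I m) - J m * J2 m) = l * (J m + N m) * I (Suc m)" .
  have "a * ((I (Suc m) * J2 m - J m * K (Suc m)) * (J m + N m)) =
        a * ((I (Suc m) * (K m - I m) - J m * J2 m) * I (Suc m))"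
    unfolding mult.assoc[symmetric] 3 4 by (simp add: mult_ac)
  then show ?thesis using a by simp
qed

section \<open>Second moments by integration by parts\<close>

text \<open>Integrate the derivative of \<open>X * (p n * p n)\<close>. Since
  \<open>X * pderiv (p n)\<close> has leading coefficient \<open>n\<close>, orthogonality turns the
  left side into \<open>(2 * n + 1) * N n\<close>.\<close>

lemma K_eq: "2 * t * K n = (2 * n + 1 + 2 * \<alpha>) * N n + (2 * t - 2 * \<alpha>) * I n"
proof -
  let ?q = "X * pderiv (p n)"
  have c: "coeff ?q n = n"
    by (cases n) (simp_all add: coeff_pderiv)
  have "L 0 (p n * ?q) = coeff ?q n * N n"
  proof (rule orth_top)
    fix k assume "n < k"
    then show "coeff ?q k = 0"
      by (cases k) (simp_all add: coeff_pderiv coeff_p_above)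
  qed
  then have 1: "L 0 (p n * ?q) = n * N n"
    by (simp only: c)
  have 2: "pderiv (X * (p n * p n)) = p n * p n + (p n * ?q + p n * ?q)"
    by (simp add: pderiv_mult algebra_simps)
  have 3: "L 0 (pderiv (X * (p n * p n))) = (2 * n + 1) * N n"
    by (simp only: 2 lin 1 orth if_True) (simp add: algebra_simps)
  have 4: "L 1 (X * (X * (p n * p n))) = I n - N n"
    using L_XX[of 0 "p n * p n"] by (simp add: I_def orth)
  have 5: "L 2 (X * (X * (p n * p n))) = K n - I n"
    using L_XX[of 1 "p n * p n"] by (simp add: I_def K_def numeral_2_eq_2)
  have "(2 * n + 1) * N n = 2 * \<alpha> * (I n - N n) + 2 * t * (K n - I n)"
    using moment_pderiv_X[OF \<alpha>_pos t_pos, of "X * (p n * p n)"] unfolding 3 4 5 .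
  then show ?thesis
    by (simp add: algebra_simps)
qed

text \<open>Integrate the derivative of \<open>p (Suc m) * p m\<close>; only the term that
  differentiates the factor of higher degree survives orthogonality.\<close>

lemma J2_eq: "2 * t * J2 m = Suc m * N m - 2 * \<alpha> * J m"
proof -
  have c: "coeff (pderiv (p (Suc m))) m = Suc m"
    by (simp add: coeff_pderiv)
  have 1: "L 0 (p m * pderiv (p (Suc m))) = Suc m * N m"
    unfolding c[symmetric] by (rule orth_top) (simp add: coeff_pderiv coeff_p_above)
  have 2: "L 0 (p (Suc m) * pderiv (p m)) = 0"
    by (rule orth_lower[of m]) (simp_all add: coeff_pderiv coeff_p_above)
  have "L 0 (pderiv (p (Suc m) * p m)) = Suc m * N m"
    by (simp only: pderiv_mult lin 1 2 add_0)
  then show ?thesis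
    using moment_pderiv_X[OF \<alpha>_pos t_pos, of "p (Suc m) * p m"]
    unfolding J_def[symmetric] J2_def[symmetric] by linarith
qed

section \<open>The time derivative of an orthogonal polynomial, determined at a fixed time\<close>

text \<open>\<open>D\<close> stands for the time derivative of \<open>p m\<close>, its third
  hypothesis being the differentiated orthogonality; \<open>E\<close> is a candidate for
  \<open>2 * t * (1 - X * X) * D\<close>. With \<open>E = (1 - X * X) * q1\<close>, the defect
  \<open>d = q1 - smult (2 * t) D\<close> has degree below \<open>m\<close> and turns out orthogonal
  to itself.\<close>

lemma orthogonal_variation_eq:
  assumes D: "has_parity m D" "\<And>k. m \<le> k \<Longrightarrow> coeff D k = 0"
    "\<And>q. (\<And>k. m \<le> k \<Longrightarrow> coeff q k = 0) \<Longrightarrow> L 0 (D * q) = L 1 (p m * q)"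
  and E: "has_parity m E" "\<And>k. m < k \<Longrightarrow> coeff E k = 0" "poly E 1 = 0" "L 1 (E * p m) = 0"
    "\<And>q. (\<And>k. m < k + 2 \<Longrightarrow> coeff q k = 0) \<Longrightarrow> L 0 (E * q) = 2 * t * I m * coeff (X * (X * q)) m"
  shows "(1 - X * X) * D = smult (1 / (2 * t)) E"
proof -
  obtain q1 where q1: "E = (1 - X * X) * q1" "has_parity m q1" "\<And>k. m < k + 2 \<Longrightarrow> coeff q1 k = 0"
    using divide_one_minus_X2[OF E(1,3,2)] by blast
  define d where "d = q1 - smult (2 * t) D"
  have cd: "coeff d k = 0" if "m \<le> k" for k
    using that by (simp add: d_def q1 D)
  have "has_parity m d"
    unfolding d_def by (intro has_parity_diff has_parity_smult q1 D)
  \<comment> \<open>Splitting off \<open>smult l (p m)\<close> makes the rest of \<open>d\<close>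
    divisible by \<open>1 - X * X\<close>; both \<open>q1\<close> and \<open>D\<close> can be paired
    with the two pieces.\<close>
  define l where "l = poly d 1 / poly (p m) 1"
  have "has_parity m (d - smult l (p m))"
    by (intro has_parity_diff has_parity_smult \<open>has_parity m d\<close> parity_p)
  then obtain q2 where q2: "d - smult l (p m) = (1 - X * X) * q2"
    "\<And>k. m < k + 2 \<Longrightarrow> coeff q2 k = 0"
    "coeff (X * (X * q2)) m = - coeff (d - smult l (p m)) m"
    by (rule divide_one_minus_X2) (use cd p_at_1 in \<open>auto simp: l_def coeff_p_above\<close>)
  have dd: "d = smult l (p m) + (1 - X * X) * q2"
    using q2(1) by (simp add: algebra_simps)
  have c: "coeff (X * (X * q2)) m = l"
    using q2(3) cd by simp
  have "L 0 (q1 * d) = L 1 (E * d)"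
    using L_reduce[of 0 "q1 * d"] by (simp add: q1 mult_ac)
  also have "\<dots> = l * L 1 (E * p m) + L 0 (E * q2)"
    using L_reduce_left[of 0 E q2] by (simp add: dd distrib_left lin)
  also have "\<dots> = 2 * t * I m * l"
    using E(4) E(5)[OF q2(2)] by (simp add: c)
  finally have 1: "L 0 (q1 * d) = 2 * t * I m * l" .
  have "L 0 (D * d) = L 1 (p m * d)"
    by (rule D(3)) (rule cd)
  also have "\<dots> = l * I m + L 0 (p m * q2)"
    using L_reduce_left[of 0 "p m" q2] by (simp add: dd distrib_left lin I_def)
  also have "L 0 (p m * q2) = 0"
    by (rule orth_lower[of m]) (use q2(2) in simp_all)
  finally have "L 0 (D * d) = l * I m" by simp
  with 1 have "L 0 ((q1 - smult (2 * t) D) * d) = 0"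
    by (simp add: left_diff_distrib lin)
  then have "d = 0"
    unfolding d_def[symmetric] by (rule L_square_eq_0)
  then show ?thesis using t_pos by (simp add: d_def q1 mult_ac)
qed

text \<open>The candidate is the combination of \<open>lower_split\<close>, with the endpoint values
  replaced by \<open>I (Suc m)\<close> and \<open>J m\<close>, which are in the same ratio. This
  choice also makes the pairing with \<open>s * p (Suc m)\<close> cancel, where
  \<open>s = 1 / (1 - y\<^sup>2)\<close>.\<close>

lemma variation_lower:
  assumes D: "has_parity (Suc m) D" "\<And>k. Suc m \<le> k \<Longrightarrow> coeff D k = 0"
    "\<And>q. (\<And>k. Suc m \<le> k \<Longrightarrow> coeff q k = 0) \<Longrightarrow> L 0 (D * q) = L 1 (p (Suc m) * q)"
  shows "(1 - X * X) * D = smult (1 / N m) (smult (I (Suc m)) (X * p m) - smult (J m) (p (Suc m)))"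
proof -
  define E where "E = smult (2 * t / N m) (smult (I (Suc m)) (X * p m) - smult (J m) (p (Suc m)))"
  have "(1 - X * X) * D = smult (1 / (2 * t)) E"
  proof (rule orthogonal_variation_eq[OF D])
    show "has_parity (Suc m) E"
      unfolding E_def by (intro has_parity_diff has_parity_smult has_parity_X_mult parity_p)
    show "coeff E k = 0" if "Suc m < k" for k
      using that by (simp add: E_def coeff_X_p coeff_p_above)
    show "poly E 1 = 0"
      using endpoint_lower[of m] by (simp add: E_def mult_ac)
    show "L 1 (E * p (Suc m)) = 0"
      unfolding E_def by (simp add: left_diff_distrib lin, simp add: I_def J_def mult_ac)
    show "L 0 (E * q) = 2 * t * I (Suc m) * coeff (X * (X * q)) (Suc m)"
      if q: "\<And>k. Suc m < k + 2 \<Longrightarrow> coeff q k = 0" for q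
      using orth_X_top[OF q] orth_lower[of "Suc m" "Suc m" q] q N_pos[of m]
      by (simp add: E_def left_diff_distrib lin mult.assoc)
  qed
  then show ?thesis using t_pos by (simp add: E_def)
qed

text \<open>The term with \<open>(1 - X * X) * p m\<close> vanishes at the endpoints, so
  \<open>endpoint_upper\<close> still applies; its job is to cancel the top term of
  \<open>X * p (Suc m)\<close> and bring the degree down to \<open>m\<close>.\<close>

lemma variation_upper:
  assumes D: "has_parity m D" "\<And>k. m \<le> k \<Longrightarrow> coeff D k = 0"
    "\<And>q. (\<And>k. m \<le> k \<Longrightarrow> coeff q k = 0) \<Longrightarrow> L 0 (D * q) = L 1 (p m * q)"
  shows "(1 - X * X) * D = smult (1 / N m) (smult (J m + N m) (p m) -
    smult (I m) ((1 - X * X) * p m) - smult (I m) (X * p (Suc m)))"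
proof -
  define E where "E = smult (2 * t / N m) (smult (J m + N m) (p m) -
    smult (I m) ((1 - X * X) * p m) - smult (I m) (X * p (Suc m)))"
  have "(1 - X * X) * D = smult (1 / (2 * t)) E"
  proof (rule orthogonal_variation_eq[OF D])
    have "has_parity m ((1 - X * X) * p m)"
      using parity_p[of m] by (simp add: has_parity_def)
    moreover have "has_parity m (X * p (Suc m))"
      using has_parity_X_mult[OF parity_p[of "Suc m"]] by simp
    ultimately show par: "has_parity m E"
      unfolding E_def by (intro has_parity_diff has_parity_smult parity_p)
    show "coeff E k = 0" if "m < k" for k
    proof -
      have "k = Suc m \<or> k = Suc (Suc m) \<or> m + 2 < k"
        using that by presburger
      then show ?thesis
        using has_parity_coeff[OF par]
        by (elim disjE) (auto simp: E_def coeff_p_above coeff_X_p coeff_XX_p algebra_simps)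
    qed
    show "poly E 1 = 0"
      using endpoint_upper[of m] by (simp add: E_def algebra_simps)
    have "L 1 ((1 - X * X) * p m * p m) = N m"
      using L_reduce[of 0 "p m * p m"] by (simp add: orth mult.assoc)
    then show "L 1 (E * p m) = 0"
      unfolding E_def
      by (simp add: left_diff_distrib[of _ _ "p m"] lin, simp add: I_def J_def algebra_simps)
    show "L 0 (E * q) = 2 * t * I m * coeff (X * (X * q)) m"
      if q: "\<And>k. m < k + 2 \<Longrightarrow> coeff q k = 0" for q
    proof -
      have "L 0 (p m * q) = 0"
        by (rule orth_lower[of m]) (use q in auto)
      moreover have "L 0 (p m * (X * (X * q))) = coeff (X * (X * q)) m * N m"
      proof (rule orth_top)
        fix k assume "m < k"
        then show "coeff (X * (X * q)) k = 0"
          using q by (cases k; cases "k - 1") auto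
      qed
      moreover have "L 0 (p (Suc m) * (X * q)) = 0"
      proof (rule orth_lower[of m])
        fix k assume "m \<le> k"
        then show "coeff (X * q) k = 0"
          using q by (cases k) auto
      qed simp
      ultimately show ?thesis
        using N_pos[of m] by (simp add: E_def algebra_simps lin)
    qed
  qed
  then show ?thesis using t_pos by (simp add: E_def)
qed

subsection \<open>Dependence on time\<close>

text \<open>Inserting \<open>1 - X * X\<close> raises the pole order to 2, after which the known
  form of \<open>(1 - X * X) * D\<close> applies.\<close>

lemma I_variation:
  assumes "(1 - X * X) * D = smult (1 / N m) (smult (I (Suc m)) (X * p m) - smult (J m) (p (Suc m)))"
  shows "L 1 (p (Suc m) * D) = (I (Suc m) * J2 m - J m * K (Suc m)) / N m"
proof -
  have "L 1 (p (Suc m) * D) = L 2 (p (Suc m) * ((1 - X * X) * D))"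
    using L_reduce_left[of 1 "p (Suc m)" D] by (simp add: numeral_2_eq_2)
  then show ?thesis
    unfolding assms J2_def K_def
    by (simp add: right_diff_distrib lin diff_divide_distrib mult.left_commute)
qed

text \<open>\<open>D\<close> and \<open>D0\<close> stand for the time derivatives of
  \<open>p (Suc m)\<close> and \<open>p m\<close>. Their contributions in \<open>J2 m\<close> cancel
  against \<open>- J2 m\<close>, the term that comes from differentiating the weight.\<close>

lemma J_variation:
  assumes "(1 - X * X) * D = smult (1 / N m) (smult (I (Suc m)) (X * p m) - smult (J m) (p (Suc m)))"
    and "(1 - X * X) * D0 = smult (1 / N m) (smult (J m + N m) (p m) -
      smult (I m) ((1 - X * X) * p m) - smult (I m) (X * p (Suc m)))"
  shows "L 1 (X * (D * p m + p (Suc m) * D0)) - J2 m =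
    (I (Suc m) * (K m - I m) - I m * J m - I m * (K (Suc m) - I (Suc m))) / N m"
proof -
  have xx: "L 2 (X * (X * q)) = L 2 q - L 1 q" for q
    using L_XX[of 1 q] by (simp add: numeral_2_eq_2)
  have "L 1 (X * p m * D) = L 2 (X * p m * ((1 - X * X) * D))"
    using L_reduce_left[of 1 "X * p m" D] by (simp add: numeral_2_eq_2)
  also have "\<dots> = (I (Suc m) * (K m - I m) - J m * J2 m) / N m"
    unfolding assms J2_def K_def I_def
    by (simp add: right_diff_distrib lin diff_divide_distrib mult_ac xx)
  finally have 1: "L 1 (X * p m * D) = (I (Suc m) * (K m - I m) - J m * J2 m) / N m" .
  have 2: "L 2 (X * p (Suc m) * ((1 - X * X) * p m)) = J m"
    using L_reduce_left[of 1 "X * p (Suc m)" "p m"] by (simp add: numeral_2_eq_2 J_def mult.assoc)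
  have "L 1 (X * p (Suc m) * D0) = L 2 (X * p (Suc m) * ((1 - X * X) * D0))"
    using L_reduce_left[of 1 "X * p (Suc m)" D0] by (simp add: numeral_2_eq_2)
  also have "\<dots> = ((J m + N m) * J2 m - I m * J m - I m * L 2 (X * p (Suc m) * (X * p (Suc m)))) / N m"
    unfolding assms
    by (simp only: right_diff_distrib[of "X * p (Suc m)"] mult_smult_right lin 2)
       (simp add: J2_def mult.assoc diff_divide_distrib)
  also have "L 2 (X * p (Suc m) * (X * p (Suc m))) = K (Suc m) - I (Suc m)"
    using xx[of "p (Suc m) * p (Suc m)"] by (simp add: K_def I_def mult_ac)
  finally have 3: "L 1 (X * p (Suc m) * D0) =
    ((J m + N m) * J2 m - I m * J m - I m * (K (Suc m) - I (Suc m))) / N m" .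
  have "L 1 (X * (D * p m + p (Suc m) * D0)) = L 1 (X * p m * D) + L 1 (X * p (Suc m) * D0)"
    by (simp add: distrib_left lin mult_ac)
  then show ?thesis
    unfolding 1 3 using N_pos[of m] by (simp add: field_simps)
qed

end

section \<open>Families of polynomials that are differentiable in time\<close>

text \<open>Differentiability is coefficientwise. The common degree bound over all positive times
  turns a moment into a finite sum of fixed length.\<close>

definition poly_has_derivative :: "(real \<Rightarrow> real poly) \<Rightarrow> real poly \<Rightarrow> real \<Rightarrow> bool" where
  "poly_has_derivative f f' t \<longleftrightarrow>
     (\<forall>k. ((\<lambda>s. coeff (f s) k) has_real_derivative coeff f' k) (at t)) \<and>
     (\<exists>M. degree f' \<le> M \<and> (\<forall>s>0. degree (f s) \<le> M))"

lemma poly_has_derivativeD: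
  "poly_has_derivative f f' t \<Longrightarrow> ((\<lambda>s. coeff (f s) k) has_real_derivative coeff f' k) (at t)"
  by (simp add: poly_has_derivative_def)

lemma has_real_derivative_cong_pos:
  fixes f g :: "real \<Rightarrow> real"
  assumes "(f has_real_derivative d) (at t)" "0 < t" "\<And>s. 0 < s \<Longrightarrow> f s = g s"
  shows "(g has_real_derivative d) (at t)"
  by (rule has_field_derivative_transform_within_open[OF assms(1), of "{0<..}"]) (use assms in auto)

lemma poly_has_derivative_cong:
  assumes "poly_has_derivative f f' t" "0 < t" "\<And>s. 0 < s \<Longrightarrow> f s = g s"
  shows "poly_has_derivative g f' t"
  unfolding poly_has_derivative_def
proof (intro conjI allI)
  show "((\<lambda>s. coeff (g s) k) has_real_derivative coeff f' k) (at t)" for k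
    by (rule has_real_derivative_cong_pos[OF poly_has_derivativeD[OF assms(1)] assms(2)])
       (simp add: assms(3))
  show "\<exists>M. degree f' \<le> M \<and> (\<forall>s>0. degree (g s) \<le> M)"
    using assms by (simp add: poly_has_derivative_def)
qed

lemma poly_has_derivative_const: "poly_has_derivative (\<lambda>_. q) 0 t"
  by (auto simp: poly_has_derivative_def)

lemma poly_has_derivative_diff:
  assumes "poly_has_derivative f f' t" "poly_has_derivative g g' t"
  shows "poly_has_derivative (\<lambda>s. f s - g s) (f' - g') t"
proof -
  obtain M1 M2 where "degree f' \<le> M1" "\<forall>s>0. degree (f s) \<le> M1"
    "degree g' \<le> M2" "\<forall>s>0. degree (g s) \<le> M2"
    using assms unfolding poly_has_derivative_def by blast
  then have "degree (f' - g') \<le> M1 + M2 \<and> (\<forall>s>0. degree (f s - g s) \<le> M1 + M2)"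
    by (auto intro!: degree_diff_le intro: trans_le_add1 trans_le_add2)
  then show ?thesis
    using assms unfolding poly_has_derivative_def
    by (intro conjI allI exI) (auto intro!: DERIV_diff)
qed

lemma poly_has_derivative_mult:
  assumes "poly_has_derivative f f' t" "poly_has_derivative g g' t" "0 < t"
  shows "poly_has_derivative (\<lambda>s. f s * g s) (f' * g t + f t * g') t"
proof -
  obtain M1 M2 where M: "degree f' \<le> M1" "\<forall>s>0. degree (f s) \<le> M1"
    "degree g' \<le> M2" "\<forall>s>0. degree (g s) \<le> M2"
    using assms unfolding poly_has_derivative_def by blast
  have "degree (f' * g t + f t * g') \<le> M1 + M2"
    using M assms(3) by (intro degree_add_le order_trans[OF degree_mult_le] add_mono) auto
  moreover have "\<forall>s>0. degree (f s * g s) \<le> M1 + M2"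
    using M by (intro allI impI order_trans[OF degree_mult_le] add_mono) auto
  moreover have "((\<lambda>s. coeff (f s * g s) k) has_real_derivative coeff (f' * g t + f t * g') k) (at t)" for k
  proof -
    have "((\<lambda>s. \<Sum>i\<le>k. coeff (f s) i * coeff (g s) (k - i)) has_real_derivative
      (\<Sum>i\<le>k. coeff f' i * coeff (g t) (k - i) + coeff g' (k - i) * coeff (f t) i)) (at t)"
      by (intro DERIV_sum DERIV_mult poly_has_derivativeD assms)
    then show ?thesis
      by (simp add: coeff_mult sum.distrib mult.commute[of "coeff g' _"])
  qed
  ultimately show ?thesis
    unfolding poly_has_derivative_def by blast
qed

lemma poly_has_derivative_smult:
  assumes "(c has_real_derivative c') (at t)" "poly_has_derivative f f' t" "0 < t"
  shows "poly_has_derivative (\<lambda>s. smult (c s) (f s)) (smult c' (f t) + smult (c t) f') t"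
proof -
  have "poly_has_derivative (\<lambda>s. [:c s:]) [:c':] t"
    unfolding poly_has_derivative_def
    using assms(1) by (auto simp: coeff_pCons split: nat.split)
  from poly_has_derivative_mult[OF this assms(2,3)] show ?thesis by simp
qed

lemma poly_has_derivative_coeff_const:
  assumes "poly_has_derivative f f' t" "0 < t" "\<And>s. 0 < s \<Longrightarrow> coeff (f s) k = c"
  shows "coeff f' k = 0"
proof -
  have "((\<lambda>_. c) has_real_derivative coeff f' k) (at t)"
    by (rule has_real_derivative_cong_pos[OF poly_has_derivativeD[OF assms(1)] assms(2,3)])
  then show ?thesis using DERIV_const DERIV_unique by blast
qed

lemma moment_expand:
  assumes "0 < \<alpha>" "0 < t" "degree q \<le> M"
  shows "moment \<alpha> j t q = (\<Sum>k\<le>M. coeff q k * moment \<alpha> j t (monom 1 k))"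
proof -
  have "moment \<alpha> j t (\<Sum>k\<le>M. smult (coeff q k) (monom 1 k)) =
      (\<Sum>k\<le>M. coeff q k * moment \<alpha> j t (monom 1 k))"
    by (simp only: moment_sum[OF assms(1,2)] moment_smult)
  then show ?thesis
    using poly_as_sum_of_monoms'[OF assms(3)] by (simp add: smult_monom)
qed

text \<open>Expansion in monomials separates the time dependence of the coefficients from that of
  the weight, and the product rule gives one term for each.\<close>

lemma moment_has_derivative_poly:
  assumes "0 < \<alpha>" "0 < t" "poly_has_derivative f f' t"
  shows "((\<lambda>s. moment \<alpha> j s (f s)) has_real_derivative
    moment \<alpha> j t f' - moment \<alpha> (Suc j) t (f t)) (at t)"
proof -
  obtain M where M: "degree f' \<le> M" "\<And>s. 0 < s \<Longrightarrow> degree (f s) \<le> M"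
    using assms(3) unfolding poly_has_derivative_def by blast
  have "((\<lambda>s. \<Sum>k\<le>M. coeff (f s) k * moment \<alpha> j s (monom 1 k)) has_real_derivative
      (\<Sum>k\<le>M. coeff f' k * moment \<alpha> j t (monom 1 k) +
        - moment \<alpha> (Suc j) t (monom 1 k) * coeff (f t) k)) (at t)"
    by (intro DERIV_sum DERIV_mult poly_has_derivativeD moment_has_derivative assms)
  also have "(\<Sum>k\<le>M. coeff f' k * moment \<alpha> j t (monom 1 k) +
        - moment \<alpha> (Suc j) t (monom 1 k) * coeff (f t) k) = moment \<alpha> j t f' - moment \<alpha> (Suc j) t (f t)"
    using moment_expand[OF assms(1,2) M(1), of j] moment_expand[OF assms(1,2) M(2)[OF assms(2)], of "Suc j"]
    by (simp add: sum.distrib sum_negf sum_subtractf mult.commute)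
  finally show ?thesis
  proof (rule has_real_derivative_cong_pos)
    fix s :: real assume "0 < s"
    then show "(\<Sum>k\<le>M. coeff (f s) k * moment \<alpha> j s (monom 1 k)) = moment \<alpha> j s (f s)"
      using moment_expand[OF assms(1) _ M(2), of s s j] by simp
  qed (rule assms)
qed

section \<open>The orthogonal polynomials and their moments as functions of time\<close>

locale orth_family =
  fixes \<alpha> :: real and P :: "nat \<Rightarrow> real \<Rightarrow> real poly" and h :: "nat \<Rightarrow> real \<Rightarrow> real"
  assumes \<alpha>_pos: "0 < \<alpha>" and family: "monic_orthogonal \<alpha> P h"
begin

lemma orth_polys:
  assumes "0 < t"
  shows "orth_polys \<alpha> t (\<lambda>n. P n t) (\<lambda>n. h n t)"
proof
  have *: "degree (P n t) = n \<and> lead_coeff (P n t) = 1"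
    "integral {-1..1} (\<lambda>x. poly (P m t) x * poly (P n t) x * weight \<alpha> t x) = (if m = n then h n t else 0)"
    for m n
    using family assms unfolding monic_orthogonal_def by blast+
  show "degree (P n t) = n" "lead_coeff (P n t) = 1" for n
    using *(1) by blast+
  show "moment \<alpha> 0 t (P m t * P n t) = (if m = n then h n t else 0)" for m n
    using *(2)[of m n] by (simp add: moment_def)
qed (use \<alpha>_pos assms in auto)

lemma h_eq: "0 < t \<Longrightarrow> moment \<alpha> 0 t (P n t * P n t) = h n t"
  using orth_polys.orth[OF orth_polys, of t n n] by simp

lemma h_has_derivative_aux:
  assumes "0 < t" "poly_has_derivative (P n) D t"
  shows "((\<lambda>s. h n s) has_real_derivative
    moment \<alpha> 0 t (D * P n t + P n t * D) - moment \<alpha> 1 t (P n t * P n t)) (at t)"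
  using has_real_derivative_cong_pos[OF moment_has_derivative_poly[OF \<alpha>_pos assms(1)
        poly_has_derivative_mult[OF assms(2,2,1)], of 0] assms(1) h_eq]
  by simp

text \<open>Differentiability in time is not assumed but derived from the recurrence, whose
  coefficient is a quotient of norms, hence of moments of earlier polynomials. Two consecutive
  degrees are carried along because the recurrence reaches back two steps.\<close>

lemma P_has_derivative:
  assumes t: "0 < t"
  shows "(\<exists>D. poly_has_derivative (P n) D t) \<and> (\<exists>D. poly_has_derivative (P (Suc n)) D t)"
proof (induction n)
  case 0
  have "poly_has_derivative (P 0) 0 t"
    by (rule poly_has_derivative_cong[OF poly_has_derivative_const[of 1] t])
       (metis orth_polys.p_0 orth_polys)
  moreover have "poly_has_derivative (P (Suc 0)) 0 t"
    by (rule poly_has_derivative_cong[OF poly_has_derivative_const[of X] t])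
       (metis orth_polys.p_1 orth_polys)
  ultimately show ?case by blast
next
  case (Suc n)
  then obtain D D1 where D: "poly_has_derivative (P n) D t" "poly_has_derivative (P (Suc n)) D1 t"
    by blast
  have "h n t \<noteq> 0"
    using orth_polys.N_pos[OF orth_polys[OF t], of n] by simp
  then obtain b where b: "((\<lambda>s. h (Suc n) s / h n s) has_real_derivative b) (at t)"
    using DERIV_divide[OF h_has_derivative_aux[OF t D(2)] h_has_derivative_aux[OF t D(1)]] by blast
  have "poly_has_derivative (\<lambda>s. X * P (Suc n) s - smult (h (Suc n) s / h n s) (P n s))
     (0 * P (Suc n) t + X * D1 - (smult b (P n t) + smult (h (Suc n) t / h n t) D)) t"
    by (intro poly_has_derivative_diff poly_has_derivative_mult poly_has_derivative_smult
        poly_has_derivative_const t D b)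
  then have "poly_has_derivative (P (Suc (Suc n)))
     (0 * P (Suc n) t + X * D1 - (smult b (P n t) + smult (h (Suc n) t / h n t) D)) t"
  proof (rule poly_has_derivative_cong[OF _ t])
    fix s :: real assume "0 < s"
    then show "X * P (Suc n) s - smult (h (Suc n) s / h n s) (P n s) = P (Suc (Suc n)) s"
      using orth_polys.recurrence[OF orth_polys, of s n] by simp
  qed
  with D show ?case by blast
qed

text \<open>These are the hypotheses on \<open>D\<close> in the variation lemmas, each obtained by
  differentiating an identity valid at all positive times: fixed top coefficients, vanishing
  coefficients of wrong parity, and orthogonality.\<close>

lemma P_derivative:
  assumes t: "0 < t" and D: "poly_has_derivative (P n) D t"
  shows "has_parity n D" "\<And>k. n \<le> k \<Longrightarrow> coeff D k = 0"
    "\<And>q. (\<And>k. n \<le> k \<Longrightarrow> coeff q k = 0) \<Longrightarrow> moment \<alpha> 0 t (D * q) = moment \<alpha> 1 t (P n t * q)"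
proof -
  show above: "coeff D k = 0" if "n \<le> k" for k
  proof (rule poly_has_derivative_coeff_const[OF D t])
    fix s :: real assume s: "0 < s"
    show "coeff (P n s) k = of_bool (k = n)"
      using orth_polys.coeff_p_self[OF orth_polys[OF s]]
        orth_polys.coeff_p_above[OF orth_polys[OF s]] that by (cases "k = n") auto
  qed
  show "has_parity n D"
    unfolding has_parity_iff_pcompose
  proof (rule poly_eqI)
    fix k
    show "coeff (pcompose D [:0, -1:]) k = coeff (smult ((- 1) ^ n) D) k"
    proof (cases "(- 1) ^ k = ((- 1) ^ n :: real)")
      case False
      have "coeff D k = 0"
      proof (rule poly_has_derivative_coeff_const[OF D t])
        fix s :: real assume s: "0 < s"
        have "pcompose (P n s) [:0, -1:] = smult ((- 1) ^ n) (P n s)"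
          using orth_polys.parity_p[OF orth_polys[OF s]] by (simp add: has_parity_iff_pcompose)
        then show "coeff (P n s) k = 0"
          using coeff_pcompose_linear[of "P n s" "-1" k] False by simp
      qed
      then show ?thesis by (simp add: coeff_pcompose_linear)
    qed (simp add: coeff_pcompose_linear)
  qed
  show "moment \<alpha> 0 t (D * q) = moment \<alpha> 1 t (P n t * q)" if q: "\<And>k. n \<le> k \<Longrightarrow> coeff q k = 0" for q
  proof -
    have "((\<lambda>_. 0) has_real_derivative
        moment \<alpha> 0 t (D * q + P n t * 0) - moment \<alpha> (Suc 0) t (P n t * q)) (at t)"
    proof (rule has_real_derivative_cong_pos[OF moment_has_derivative_poly[OF \<alpha>_pos t
          poly_has_derivative_mult[OF D poly_has_derivative_const t]] t])
      fix s :: real assume "0 < s"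
      then show "moment \<alpha> 0 s (P n s * q) = 0"
        using orth_polys.orth_lower[OF orth_polys order_refl q] by simp
    qed
    from DERIV_unique[OF this DERIV_const] show ?thesis by simp
  qed
qed

definition I :: "nat \<Rightarrow> real \<Rightarrow> real" where "I n t = moment \<alpha> 1 t (P n t * P n t)"
definition K :: "nat \<Rightarrow> real \<Rightarrow> real" where "K n t = moment \<alpha> 2 t (P n t * P n t)"
definition J :: "nat \<Rightarrow> real \<Rightarrow> real" where "J m t = moment \<alpha> 1 t (X * (P (Suc m) t * P m t))"
definition J2 :: "nat \<Rightarrow> real \<Rightarrow> real" where "J2 m t = moment \<alpha> 2 t (X * (P (Suc m) t * P m t))"

text \<open>The derivative of \<open>P n\<close> has degree below \<open>n\<close>, so it is
  orthogonal to \<open>P n\<close> and only the derivative of the weight contributes.\<close>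

lemma h_has_derivative:
  assumes t: "0 < t"
  shows "(h n has_real_derivative - I n t) (at t)"
proof -
  interpret o: orth_polys \<alpha> t "\<lambda>n. P n t" "\<lambda>n. h n t" by (rule orth_polys[OF t])
  obtain D where D: "poly_has_derivative (P n) D t" using P_has_derivative[OF t] by blast
  have "o.L 0 (P n t * D) = 0"
    by (rule o.orth_lower[OF order_refl]) (rule P_derivative(2)[OF t D])
  then have "moment \<alpha> 0 t (D * P n t + P n t * D) = 0"
    by (simp only: o.lin mult.commute[of D] add_0)
  with h_has_derivative_aux[OF t D] show ?thesis by (simp add: I_def)
qed

lemma I_has_derivative_aux:
  assumes "0 < t" "poly_has_derivative (P n) D t"
  shows "(I n has_real_derivative 2 * moment \<alpha> 1 t (P n t * D) - K n t) (at t)"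
proof -
  have "moment \<alpha> 1 t (D * P n t + P n t * D) = 2 * moment \<alpha> 1 t (P n t * D)"
    by (simp only: mult.commute[of D] moment_add[OF \<alpha>_pos assms(1)] mult_2)
  then show ?thesis
    using moment_has_derivative_poly[OF \<alpha>_pos assms(1)
        poly_has_derivative_mult[OF assms(2,2,1)], of 1]
    unfolding I_def[abs_def] K_def by (simp add: numeral_2_eq_2)
qed

lemma I_0_has_derivative:
  assumes t: "0 < t"
  shows "(I 0 has_real_derivative - K 0 t) (at t)"
proof -
  obtain D where D: "poly_has_derivative (P 0) D t" using P_has_derivative[OF t] by blast
  have "D = 0"
    using P_derivative(2)[OF t D] by (simp add: poly_eq_iff)
  then show ?thesis using I_has_derivative_aux[OF t D] by (simp add: moment_0)
qed

lemma I_Suc_has_derivative: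
  assumes t: "0 < t"
  shows "(I (Suc m) has_real_derivative
    2 * ((I (Suc m) t * J2 m t - J m t * K (Suc m) t) / h m t) - K (Suc m) t) (at t)"
proof -
  interpret o: orth_polys \<alpha> t "\<lambda>n. P n t" "\<lambda>n. h n t" by (rule orth_polys[OF t])
  obtain D where D: "poly_has_derivative (P (Suc m)) D t" using P_has_derivative[OF t] by blast
  have "moment \<alpha> 1 t (P (Suc m) t * D) = (I (Suc m) t * J2 m t - J m t * K (Suc m) t) / h m t"
    using o.I_variation[OF o.variation_lower[OF P_derivative[OF t D]]]
    unfolding o.I_def o.K_def o.J_def o.J2_def I_def K_def J_def J2_def .
  then show ?thesis
    using I_has_derivative_aux[OF t D] by simp
qed

lemma J_has_derivative:
  assumes t: "0 < t"
  shows "(J m has_real_derivative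
    (I (Suc m) t * (K m t - I m t) - I m t * J m t - I m t * (K (Suc m) t - I (Suc m) t)) / h m t) (at t)"
proof -
  interpret o: orth_polys \<alpha> t "\<lambda>n. P n t" "\<lambda>n. h n t" by (rule orth_polys[OF t])
  obtain D D0 where D: "poly_has_derivative (P (Suc m)) D t" and D0: "poly_has_derivative (P m) D0 t"
    using P_has_derivative[OF t] by blast
  have "(J m has_real_derivative moment \<alpha> 1 t (X * (D * P m t + P (Suc m) t * D0)) - J2 m t) (at t)"
    using moment_has_derivative_poly[OF \<alpha>_pos t poly_has_derivative_mult[OF
          poly_has_derivative_const[of X] poly_has_derivative_mult[OF D D0 t] t], of 1]
    unfolding J_def[abs_def] J2_def by (simp add: numeral_2_eq_2)
  moreover have "moment \<alpha> 1 t (X * (D * P m t + P (Suc m) t * D0)) - J2 m t =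
    (I (Suc m) t * (K m t - I m t) - I m t * J m t - I m t * (K (Suc m) t - I (Suc m) t)) / h m t"
    using o.J_variation[OF o.variation_lower[OF P_derivative[OF t D]]
      o.variation_upper[OF P_derivative[OF t D0]]]
    unfolding o.I_def o.K_def o.J_def o.J2_def I_def K_def J_def J2_def .
  ultimately show ?thesis by simp
qed

end

subsection \<open>From the Riccati system to the second-order equations\<close>

lemma deriv_cong_pos:
  fixes f f' :: "real \<Rightarrow> real"
  assumes "\<And>s. 0 < s \<Longrightarrow> (f has_real_derivative f' s) (at s)" "0 < t" "(f' has_real_derivative d) (at t)"
  shows "(deriv f has_real_derivative d) (at t)"
  by (rule has_real_derivative_cong_pos[OF assms(3,2)]) (use assms(1) DERIV_imp_deriv in metis)

lemma twice_differentiable_posI: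
  fixes f f' f'' :: "real \<Rightarrow> real"
  assumes "\<And>t. 0 < t \<Longrightarrow> (f has_real_derivative f' t) (at t)"
    "\<And>t. 0 < t \<Longrightarrow> (f' has_real_derivative f'' t) (at t)"
  shows "twice_differentiable_pos f"
  unfolding twice_differentiable_pos_def field_differentiable_def
  using assms deriv_cong_pos[OF assms(1) _ assms(2)] by blast

text \<open>\<open>A\<close>, \<open>B\<close>, \<open>A2\<close> are the values of R', r', R''.
  After the Riccati equations are inserted, every term is a polynomial, and \<open>r\<close> cancels
  identically.\<close>

lemma riccati_to_R_ode:
  fixes t R r A B A2 n \<alpha> c :: real
  assumes c: "c = 2 * n + 1 + 2 * \<alpha>"
    and A: "2 * t * A = R^2 + (c + 1) * R - 2 * (r + t) * (c + R)"
    and B: "2 * t * R * B = R * (2 * r + (c - 1) * r + 2 * n * t - r * (r + 2 * t)) - 2 * c * (r * (r + 2 * t))"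
    and A2: "2 * t * A2 + 2 * A = 2 * R * A + (c + 1) * A - 2 * (B + 1) * (c + R) - 2 * (r + t) * A"
  shows "8 * t^2 * R * (2 * n + 1 + 2 * \<alpha> + R) * A2 - 4 * t^2 * (4 * n + 2 + 4 * \<alpha> + 3 * R) * A^2
      + 8 * t * R * (2 * n + 1 + 2 * \<alpha> + R) * A - R^5 - 2 * (2 * n + 1 + 2 * \<alpha>) * R^4
      - 4 * ((n + \<alpha>) * (n + 1 + \<alpha>) - t * (t - 2 * \<alpha>)) * R^3
      + 16 * t * (2 * n + 1 + 2 * \<alpha>) * (t - \<alpha>) * R^2
      + 4 * t * (2 * n + 1 + 2 * \<alpha>)^2 * (5 * t - 2 * \<alpha>) * R
      + 8 * t^2 * (2 * n + 1 + 2 * \<alpha>)^3 = 0"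
proof -
  define a where "a = R^2 + (c + 1) * R - 2 * (r + t) * (c + R)"
  define b where "b = R * (2 * r + (c - 1) * r + 2 * n * t - r * (r + 2 * t)) - 2 * c * (r * (r + 2 * t))"
  have 1: "2 * t * A = a" "2 * t * R * B = b" using A B by (simp_all add: a_def b_def)
  \<comment> \<open>The multiplier makes \<open>A\<close> and \<open>B\<close> appear only as
    \<open>2 * t * A\<close> and \<open>2 * t * R * B\<close>, which the system expresses without
    division.\<close>
  have "4 * t * R * (c + R) * (2 * t * A2) =
      2 * R * (c + R) * (2 * R + (c - 1) - 2 * (r + t)) * (2 * t * A) - 4 * (c + R)^2 * (2 * t * R * B)
      - 8 * t * R * (c + R)^2"
  proof -
    have "2 * t * A2 = (2 * R + (c - 1) - 2 * (r + t)) * A - 2 * (B + 1) * (c + R)"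
      using A2 by (simp add: algebra_simps)
    then show ?thesis by (simp only:) (simp add: algebra_simps power2_eq_square)
  qed
  then have 2: "8 * t^2 * R * (c + R) * A2 =
      2 * R * (c + R) * (2 * R + (c - 1) - 2 * (r + t)) * a - 4 * (c + R)^2 * b - 8 * t * R * (c + R)^2"
    unfolding 1 by (simp add: algebra_simps power2_eq_square)
  have 3: "4 * t^2 * (2 * c + 3 * R) * A^2 = (2 * c + 3 * R) * a^2"
    unfolding 1[symmetric] by (simp add: algebra_simps power2_eq_square)
  have 4: "8 * t * R * (c + R) * A = 4 * R * (c + R) * a"
    unfolding 1[symmetric] by (simp add: algebra_simps)
  have 5: "4 * n + 2 + 4 * \<alpha> + 3 * R = 2 * c + 3 * R"
    using c by simp
  show ?thesis
    unfolding 5 c[symmetric] 2 3 4 unfolding a_def b_def unfolding c by algebra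
qed

text \<open>\<open>Y\<close> is \<open>r * (r + 2 * t) / R\<close> and \<open>Y1\<close> its
  derivative. In terms of \<open>r\<close> and \<open>Y\<close> the first derivative
  \<open>B\<close> is polynomial over \<open>2 * t\<close>, and \<open>R\<close> can be removed
  altogether; in the end \<open>Y\<close> cancels identically.\<close>

lemma riccati_to_r_ode:
  fixes t R r A B B2 n \<alpha> c Y :: real
  assumes c: "c = 2 * n + 1 + 2 * \<alpha>" and "R \<noteq> 0"
    and A: "2 * t * A = R^2 + (c + 1) * R - 2 * (r + t) * (c + R)"
    and Y: "Y * R = r * (r + 2 * t)"
    and B: "2 * t * B = 2 * r + (c - 1) * r + 2 * n * t - r * (r + 2 * t) - 2 * c * Y"
    and B2: "2 * t * B2 = (c - 1) * B + 2 * n - (2 * r * B + 2 * t * B + 2 * r) - 2 * c * Y1"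
    and Y1: "Y1 * R + Y * A = 2 * r * B + 2 * t * B + 2 * r"
  shows "4 * t^2 * r * (2 * t + r) * B2 - 4 * t^2 * (t + r) * B^2 + 4 * t * r^2 * B - r^5
      - (2 * n + 2 * \<alpha> + 5 * t) * r^4 - 8 * t * (n + \<alpha> + t) * r^3
      - 4 * t * ((t + \<alpha>)^2 + n * (2 * t + \<alpha>) - 1) * r^2 + 4 * n^2 * t^2 * r + 4 * n^2 * t^3 = 0"
proof -
  define b where "b = 2 * r + (c - 1) * r + 2 * n * t - r * (r + 2 * t) - 2 * c * Y"
  have 1: "2 * t * B = b" using B by (simp add: b_def)
  define \<rho> where "\<rho> = r * (r + 2 * t)"
  have YR: "Y * R = \<rho>" using Y by (simp add: \<rho>_def)
  have aY: "2 * t * A * Y^2 = \<rho>^2 + (c + 1) * \<rho> * Y - 2 * (r + t) * (c * Y^2 + \<rho> * Y)"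
    unfolding A YR[symmetric] by (simp add: algebra_simps power2_eq_square)
  \<comment> \<open>Multiplying by \<open>\<rho> = Y * R\<close> turns \<open>Y1\<close> into
    \<open>Y1 * R\<close>, which is known, and absorbs every remaining \<open>R\<close>.\<close>
  have "\<rho> * (2 * t * Y1) = Y * (2 * t * (Y1 * R))"
    unfolding YR[symmetric] by (simp add: algebra_simps)
  also have "Y1 * R = 2 * r * B + 2 * t * B + 2 * r - Y * A" using Y1 by simp
  also have "Y * (2 * t * (2 * r * B + 2 * t * B + 2 * r - Y * A)) =
      Y * (2 * (r + t) * (2 * t * B) + 4 * t * r) - 2 * t * A * Y^2"
    by (simp add: algebra_simps power2_eq_square)
  finally have 2: "\<rho> * (2 * t * Y1) = Y * (2 * (r + t) * b + 4 * t * r) -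
      (\<rho>^2 + (c + 1) * \<rho> * Y - 2 * (r + t) * (c * Y^2 + \<rho> * Y))"
    unfolding aY 1 .
  have "4 * t^2 * r * (2 * t + r) * B2 = \<rho> * (2 * t) * (2 * t * B2)"
    by (simp add: \<rho>_def algebra_simps power2_eq_square)
  also have "\<dots> = \<rho> * ((c - 1) * (2 * t * B) + 4 * n * t - 2 * (r + t) * (2 * t * B) - 4 * t * r)
      - 2 * c * (\<rho> * (2 * t * Y1))"
    unfolding B2 by (simp add: algebra_simps)
  finally have 3: "4 * t^2 * r * (2 * t + r) * B2 =
      \<rho> * ((c - 1) * b + 4 * n * t - 2 * (r + t) * b - 4 * t * r) - 2 * c *
      (Y * (2 * (r + t) * b + 4 * t * r) -
        (\<rho>^2 + (c + 1) * \<rho> * Y - 2 * (r + t) * (c * Y^2 + \<rho> * Y)))"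
    unfolding 1 2 .
  have 4: "4 * t^2 * (t + r) * B^2 = (t + r) * b^2"
    unfolding 1[symmetric] by (simp add: algebra_simps power2_eq_square)
  have 5: "4 * t * r^2 * B = 2 * r^2 * b"
    unfolding 1[symmetric] by (simp add: algebra_simps)
  show ?thesis
    unfolding 3 4 5 unfolding b_def \<rho>_def unfolding c by algebra
qed

lemma R_ode_to_painleve:
  fixes t R A A2 n \<alpha> c :: real
  assumes "0 < t" "0 < R" "0 < c" "c = 2 * n + 1 + 2 * \<alpha>"
    and ode: "8 * t^2 * R * (2 * n + 1 + 2 * \<alpha> + R) * A2 - 4 * t^2 * (4 * n + 2 + 4 * \<alpha> + 3 * R) * A^2
      + 8 * t * R * (2 * n + 1 + 2 * \<alpha> + R) * A - R^5 - 2 * (2 * n + 1 + 2 * \<alpha>) * R^4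
      - 4 * ((n + \<alpha>) * (n + 1 + \<alpha>) - t * (t - 2 * \<alpha>)) * R^3
      + 16 * t * (2 * n + 1 + 2 * \<alpha>) * (t - \<alpha>) * R^2
      + 4 * t * (2 * n + 1 + 2 * \<alpha>)^2 * (5 * t - 2 * \<alpha>) * R
      + 8 * t^2 * (2 * n + 1 + 2 * \<alpha>)^3 = 0"
  defines "W \<equiv> (c + R) / c"
  shows "A2 / c = (3 * W - 1) * (A / c)^2 / (2 * W * (W - 1)) - (A / c) / t
          + (W - 1)^2 / t^2 * (c^2 / 8 * W + (- 1 / 8) / W) + \<alpha> * W / t
          + (- 1 / 2) * W * (W + 1) / (W - 1)"
proof -
  \<comment> \<open>\<open>E\<close> clears all denominators of the Painleve equation; up to the
    factor \<open>c\<close> it is the coefficient of R'' in the equation for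
    \<open>R\<close>.\<close>
  define E where "E = 8 * t^2 * c * R * (c + R)"
  have nz: "t \<noteq> 0" "R \<noteq> 0" "c \<noteq> 0" "c + R \<noteq> 0" "W \<noteq> 0" "E \<noteq> 0"
    using assms by (auto simp: W_def E_def)
  define s where "s = c + R"
  have s: "s \<noteq> 0" "W = s / c" "E = 8 * t^2 * c * R * s" "2 * c + 3 * R = 3 * s - c"
    using nz by (simp_all add: s_def W_def E_def)
  have W1: "W - 1 = R / c" using nz by (simp add: W_def field_simps)
  have e1: "E * ((3 * W - 1) * (A / c)^2 / (2 * W * (W - 1))) = 4 * t^2 * (2 * c + 3 * R) * A^2"
    unfolding W1 unfolding s(2-4) using nz s(1) by (simp add: field_simps power2_eq_square)
  have e2: "E * ((A / c) / t) = 8 * t * R * (c + R) * A"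
    unfolding E_def using nz by (simp add: field_simps power2_eq_square)
  have e3: "E * ((W - 1)^2 / t^2 * (c^2 / 8 * W + (- 1 / 8) / W)) = R^3 * (c + R)^2 - R^3"
    unfolding W1 s_def[symmetric] unfolding s(2,3) using nz s(1)
    by (simp add: field_simps power2_eq_square power3_eq_cube)
  have e4: "E * (\<alpha> * W / t) = 8 * \<alpha> * t * R * (c + R)^2"
    unfolding W_def E_def using nz by (simp add: field_simps power2_eq_square)
  have e5: "E * ((- 1 / 2) * W * (W + 1) / (W - 1)) = - 4 * t^2 * (c + R)^2 * (2 * c + R)"
    unfolding W1 unfolding W_def E_def using nz by (simp add: field_simps power2_eq_square)
  have e0: "E * (A2 / c) = 8 * t^2 * R * (c + R) * A2"
    unfolding E_def using nz by (simp add: field_simps)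
  have "8 * t^2 * R * (c + R) * A2 = 4 * t^2 * (2 * c + 3 * R) * A^2 - 8 * t * R * (c + R) * A
    + (R^3 * (c + R)^2 - R^3) + 8 * \<alpha> * t * R * (c + R)^2 + - 4 * t^2 * (c + R)^2 * (2 * c + R)"
    using ode unfolding assms(4) by algebra
  then have "E * (A2 / c) = E * ((3 * W - 1) * (A / c)^2 / (2 * W * (W - 1)) - (A / c) / t
          + (W - 1)^2 / t^2 * (c^2 / 8 * W + (- 1 / 8) / W) + \<alpha> * W / t
          + (- 1 / 2) * W * (W + 1) / (W - 1))"
    by (simp only: e0 e1 e2 e3 e4 e5 distrib_left[of E] right_diff_distrib[of E])
  then show ?thesis unfolding mult_left_cancel[OF nz(6)] .
qed

text \<open>The suffixes \<open>u\<close> and \<open>l\<close> mark the upper degree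
  \<open>n\<close> and the lower degree \<open>n - 1\<close>, with norms \<open>N\<close> and
  \<open>H\<close>; hence \<open>c - 2\<close> in the hypothesis for \<open>Kl\<close>.
  \<open>R'\<close> and \<open>r'\<close> are the quotient rule with the derivative of each norm
  equal to minus its first moment.\<close>

lemma riccati_algebra:
  fixes t \<alpha> n c H N Iu Il Jv Ku Kl J2 :: real
  assumes pos: "0 < t" "0 < H" "0 < N" "0 < Iu"
    and c: "c = 2 * n + 1 + 2 * \<alpha>"
    and Ku: "2 * t * Ku = c * N + (2 * t - 2 * \<alpha>) * Iu"
    and Kl: "2 * t * Kl = (c - 2) * H + (2 * t - 2 * \<alpha>) * Il"
    and J2: "2 * t * J2 = n * H - 2 * \<alpha> * Jv"
    and quad: "Jv * (Jv + H) = Iu * Il"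
    and ratio: "(Iu * J2 - Jv * Ku) * (Jv + H) = (Iu * (Kl - Il) - Jv * J2) * Iu"
  defines "R \<equiv> 2 * t * Iu / N" and "r \<equiv> 2 * t * Jv / H"
    and "R' \<equiv> (2 * Iu + 2 * t * (2 * ((Iu * J2 - Jv * Ku) / H) - Ku)) / N + 2 * t * Iu * Iu / N^2"
    and "r' \<equiv> (2 * Jv + 2 * t * ((Iu * (Kl - Il) - Il * Jv - Il * (Ku - Iu)) / H)) / H + 2 * t * Jv * Il / H^2"
  shows "2 * t * R' = R^2 + (c + 1) * R - 2 * (r + t) * (c + R)"
    and "2 * t * R * r' = R * (2 * r + (c - 1) * r + 2 * n * t - r * (r + 2 * t)) - 2 * c * (r * (r + 2 * t))"
proof -
  \<comment> \<open>Rescaled variables: each moment times \<open>2 * t\<close> becomes a multiple of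
    \<open>H\<close>, with \<open>x\<close>, \<open>y\<close>, \<open>z\<close> belonging to
    \<open>Ku\<close>, \<open>Kl - Il\<close>, \<open>J2\<close>. Then \<open>H\<close> cancels from
    every relation.\<close>
  define \<beta> where "\<beta> = N / H"
  define Q where "Q = 2 * t * Il / H"
  define w where "w = \<alpha> / t"
  define x where "x = c + R - w * R"
  define y where "y = c - 2 - w * Q"
  define z where "z = n - w * r"
  have R: "0 < R" "0 < \<beta>" using pos by (auto simp: R_def \<beta>_def)
  have \<alpha>: "\<alpha> = w * t" using pos by (simp add: w_def)
  have Iu: "2 * t * Iu = R * \<beta> * H" using pos by (simp add: R_def \<beta>_def)
  have Jv: "2 * t * Jv = r * H" using pos by (simp add: r_def)
  have Il: "2 * t * Il = Q * H" using pos by (simp add: Q_def)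
  have N: "N = \<beta> * H" using pos by (simp add: \<beta>_def)
  have "2 * t * Ku = c * N + (1 - w) * (2 * t * Iu)"
    unfolding Ku \<alpha> by (simp add: algebra_simps)
  then have Ku': "2 * t * Ku = x * \<beta> * H"
    unfolding Iu N x_def by (simp add: algebra_simps)
  have "2 * t * (Kl - Il) = (c - 2) * H - w * (2 * t * Il)"
    using Kl unfolding \<alpha> by (simp add: algebra_simps)
  then have Kl': "2 * t * (Kl - Il) = y * H"
    unfolding Il y_def by (simp add: algebra_simps)
  have "2 * t * J2 = n * H - w * (2 * t * Jv)"
    unfolding J2 \<alpha> by (simp add: algebra_simps)
  then have J2': "2 * t * J2 = z * H"
    unfolding Jv z_def by (simp add: algebra_simps)
  have "(2 * t * Jv) * (2 * t * Jv + 2 * t * H) = (2 * t * Iu) * (2 * t * Il)"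
    using arg_cong[OF quad, of "\<lambda>u. 4 * t^2 * u"] by (simp add: algebra_simps power2_eq_square)
  then have "H^2 * (r * (r + 2 * t)) = H^2 * (\<beta> * R * Q)"
    unfolding Iu Il Jv by (simp add: algebra_simps power2_eq_square)
  then have rho: "r * (r + 2 * t) = \<beta> * R * Q" using pos by simp
  have "((2 * t * Iu) * (2 * t * J2) - (2 * t * Jv) * (2 * t * Ku)) * (2 * t * Jv + 2 * t * H) =
      ((2 * t * Iu) * (2 * t * (Kl - Il)) - (2 * t * Jv) * (2 * t * J2)) * (2 * t * Iu)"
    using arg_cong[OF ratio, of "\<lambda>u. 8 * t^3 * u"]
    by (simp add: algebra_simps power2_eq_square power3_eq_cube)
  then have "(\<beta> * H^3) * ((R * z - r * x) * (r + 2 * t)) = (\<beta> * H^3) * ((\<beta> * R * y - r * z) * R)"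
    unfolding Iu Jv Ku' Kl' J2' by (simp add: algebra_simps power3_eq_cube)
  then have "(R * z - r * x) * (r + 2 * t) = (\<beta> * R * y - r * z) * R"
    using pos R by simp
  then have "R * ((n - r) * (r + 2 * t)) - c * (r * (r + 2 * t)) =
      R * (\<beta> * R * (c - 2) - w * (\<beta> * R * Q) - r * n + w * r^2)"
    unfolding x_def y_def z_def by (simp add: algebra_simps power2_eq_square)
  then have "R * ((n - r) * (r + 2 * t)) - c * (\<beta> * R * Q) =
      R * (\<beta> * R * (c - 2) - w * (r * (r + 2 * t)) - r * n + w * r^2)"
    by (simp only: rho)
  then have "R * ((n - r) * (r + 2 * t) - c * \<beta> * Q) =
      R * (\<beta> * R * (c - 2) - 2 * \<alpha> * r - r * n)"
    unfolding \<alpha> by (simp add: algebra_simps power2_eq_square)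
  then have F: "(n - r) * (r + 2 * t) - c * \<beta> * Q = \<beta> * R * (c - 2) - 2 * \<alpha> * r - r * n"
    using R by simp
  have "2 * t * R' = (2 * (2 * t * Iu) + 2 * ((2 * t * Iu) * (2 * t * J2) - (2 * t * Jv) * (2 * t * Ku)) / H
      - 2 * t * (2 * t * Ku)) / N + (2 * t * Iu)^2 / N^2"
    unfolding R'_def using pos by (simp add: field_simps power2_eq_square)
  also have "\<dots> = 2 * R + 2 * (R * z - r * x) - 2 * t * x + R^2"
    unfolding Iu J2' Jv Ku' N using pos R by (simp add: field_simps power2_eq_square)
  also have "\<dots> = R^2 + (c + 1) * R - 2 * (r + t) * (c + R)"
    unfolding x_def z_def c \<alpha> by (simp add: algebra_simps power2_eq_square)
  finally show "2 * t * R' = R^2 + (c + 1) * R - 2 * (r + t) * (c + R)" .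
  have "2 * t * r' = (2 * (2 * t * Jv) + ((2 * t * Iu) * (2 * t * (Kl - Il)) - (2 * t * Il) * (2 * t * Jv)
      - (2 * t * Il) * (2 * t * Ku - 2 * t * Iu)) / H) / H + (2 * t * Jv) * (2 * t * Il) / H^2"
    unfolding r'_def using pos by (simp add: field_simps power2_eq_square)
  also have "\<dots> = 2 * r + \<beta> * R * y - Q * \<beta> * (x - R)"
    unfolding Iu Kl' Jv Ku' Il using pos by (simp add: field_simps power2_eq_square)
  also have "\<dots> = 2 * r + (\<beta> * R * (c - 2)) - c * \<beta> * Q"
    unfolding x_def y_def by (simp add: algebra_simps)
  \<comment> \<open>\<open>F\<close> removes \<open>\<beta> * R\<close>. The remaining
    \<open>\<beta> * Q\<close> is known only after multiplication by \<open>R\<close>, through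
    \<open>rho\<close>, which explains the factor \<open>R\<close> in the second equation.\<close>
  also have "\<beta> * R * (c - 2) = (n - r) * (r + 2 * t) - c * \<beta> * Q + 2 * \<alpha> * r + r * n"
    using F by simp
  finally have e: "2 * t * r' = 2 * r + ((n - r) * (r + 2 * t) - c * \<beta> * Q + 2 * \<alpha> * r + r * n) - c * \<beta> * Q" .
  have "2 * t * R * r' = R * (2 * t * r')"
    by simp
  also have "\<dots> = R * (2 * r + (n - r) * (r + 2 * t) + 2 * \<alpha> * r + r * n) - 2 * c * (\<beta> * R * Q)"
    unfolding e by (simp add: algebra_simps)
  also have "\<dots> = R * (2 * r + (c - 1) * r + 2 * n * t - r * (r + 2 * t)) - 2 * c * (r * (r + 2 * t))"
    unfolding rho[symmetric] c by (simp add: algebra_simps)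
  finally show "2 * t * R * r' = R * (2 * r + (c - 1) * r + 2 * n * t - r * (r + 2 * t)) - 2 * c * (r * (r + 2 * t))" .
qed

section \<open>The Riccati system for the auxiliary quantities\<close>

context orth_family
begin

lemma aux_R_eq: "aux_R \<alpha> P h n t = 2 * t * I n t / h n t"
  by (simp add: aux_R_def I_def moment_def power2_eq_square)

lemma aux_r_Suc: "aux_r \<alpha> P h (Suc m) t = 2 * t * J m t / h m t"
  by (simp add: aux_r_def J_def moment_def mult.assoc)

lemma aux_r_0: "aux_r \<alpha> P h 0 t = 0"
  by (simp add: aux_r_def)

lemma h_pos: "0 < t \<Longrightarrow> 0 < h n t"
  using orth_polys.N_pos[OF orth_polys] by simp

lemma I_pos: "0 < t \<Longrightarrow> 0 < I n t"
  using orth_polys.I_pos[OF orth_polys, of t n]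
  by (simp add: I_def orth_polys.I_def[OF orth_polys])

lemma aux_R_pos: "0 < t \<Longrightarrow> 0 < aux_R \<alpha> P h n t"
  by (simp add: aux_R_eq I_pos h_pos)

lemma riccati_system:
  fixes n :: nat and t c :: real and R r :: "real \<Rightarrow> real"
  assumes t: "0 < t"
  defines "c \<equiv> 2 * real n + 1 + 2 * \<alpha>"
    and "R \<equiv> aux_R \<alpha> P h n" and "r \<equiv> aux_r \<alpha> P h n"
  obtains R' r' where
    "(R has_real_derivative R') (at t)" "(r has_real_derivative r') (at t)"
    "2 * t * R' = (R t)^2 + (c + 1) * R t - 2 * (r t + t) * (c + R t)"
    "2 * t * R t * r' = R t * (2 * r t + (c - 1) * r t + 2 * real n * t - r t * (r t + 2 * t))
       - 2 * c * (r t * (r t + 2 * t))"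
proof -
  interpret o: orth_polys \<alpha> t "\<lambda>n. P n t" "\<lambda>n. h n t" by (rule orth_polys[OF t])
  have oI: "o.I = (\<lambda>n. I n t)" "o.K = (\<lambda>n. K n t)" "o.J = (\<lambda>n. J n t)" "o.J2 = (\<lambda>n. J2 n t)"
    by (simp_all add: fun_eq_iff o.I_def o.K_def o.J_def o.J2_def I_def K_def J_def J2_def)
  have h: "h k t \<noteq> 0" for k using h_pos[OF t, of k] by simp
  have dR: "(R has_real_derivative (2 * I n t + 2 * t * d) / h n t + 2 * t * I n t * I n t / (h n t)^2) (at t)"
    if "(I n has_real_derivative d) (at t)" for d
    unfolding R_def aux_R_eq[abs_def] using h[of n]
    by (auto intro!: derivative_eq_intros h_has_derivative[OF t] that
        simp: field_simps power2_eq_square)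
  show ?thesis
  proof (cases n)
    \<comment> \<open>Without a lower degree, \<open>r\<close> is 0 by convention and the second
      equation is trivial; the first follows from \<open>K_eq\<close> alone.\<close>
    case 0
    define d where "d = (2 * I n t + 2 * t * (- K n t)) / h n t + 2 * t * I n t * I n t / (h n t)^2"
    have "(R has_real_derivative d) (at t)"
      unfolding d_def by (rule dR) (simp add: 0 I_0_has_derivative t)
    moreover have "r = (\<lambda>_. 0)"
      by (simp add: r_def 0 aux_r_0 fun_eq_iff)
    moreover have "2 * t * d = (R t)^2 + (c + 1) * R t - 2 * (0 + t) * (c + R t)"
    proof -
      have "2 * t * K n t = c * h n t + (2 * t - 2 * \<alpha>) * I n t"
        using o.K_eq[of n] by (simp add: oI c_def)
      then have K: "K n t = (c * h n t + (2 * t - 2 * \<alpha>) * I n t) / (2 * t)"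
        using t by (simp add: field_simps)
      show ?thesis
        unfolding d_def R_def aux_R_eq K using t h[of n] 0
        by (simp add: c_def field_simps power2_eq_square)
    qed
    ultimately show ?thesis
      using that[of d 0] 0 by simp
  next
    case (Suc m)
    have dr: "(r has_real_derivative (2 * J m t + 2 * t * d) / h m t + 2 * t * J m t * I m t / (h m t)^2) (at t)"
      if "(J m has_real_derivative d) (at t)" for d
      unfolding r_def Suc aux_r_Suc[abs_def] using h[of m]
      by (auto intro!: derivative_eq_intros h_has_derivative[OF t] that
          simp: field_simps power2_eq_square)
    have K: "2 * t * K (Suc m) t = c * h (Suc m) t + (2 * t - 2 * \<alpha>) * I (Suc m) t"
      "2 * t * K m t = (c - 2) * h m t + (2 * t - 2 * \<alpha>) * I m t"
      using o.K_eq[of m] o.K_eq[of "Suc m"] by (simp_all add: oI c_def Suc)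
    have J2: "2 * t * J2 m t = real n * h m t - 2 * \<alpha> * J m t"
      using o.J2_eq[of m] by (simp add: oI Suc)
    note alg = riccati_algebra[OF t h_pos[OF t] h_pos[OF t] I_pos[OF t] c_def[THEN meta_eq_to_obj_eq] K J2
        o.I_J_quadratic[of m, unfolded oI] o.second_moments_proportional[of m, unfolded oI]]
    have Rr: "R t = 2 * t * I (Suc m) t / h (Suc m) t" "r t = 2 * t * J m t / h m t"
      by (simp_all add: R_def r_def aux_R_eq Suc aux_r_Suc)
    show ?thesis
      by (rule that[OF dR[unfolded Suc, OF I_Suc_has_derivative[OF t]] dr[OF J_has_derivative[OF t]]])
         (unfold Rr, (rule alg)+)
  qed
qed

end

theorem theorem3p2:
  fixes \<alpha> :: real and n :: nat
    and P :: "nat \<Rightarrow> real \<Rightarrow> real poly" and h :: "nat \<Rightarrow> real \<Rightarrow> real"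
    and R r W :: "real \<Rightarrow> real"
  assumes "\<alpha> > 0"
    and "monic_orthogonal \<alpha> P h"
  defines "R \<equiv> aux_R \<alpha> P h n"
    and "r \<equiv> aux_r \<alpha> P h n"
    and "W \<equiv> (\<lambda>t. (2 * real n + 1 + 2 * \<alpha> + R t) / (2 * real n + 1 + 2 * \<alpha>))"
  shows "twice_differentiable_pos R \<and>
    (\<forall>t>0.
      8 * t^2 * R t * (2 * real n + 1 + 2 * \<alpha> + R t) * deriv (deriv R) t
      - 4 * t^2 * (4 * real n + 2 + 4 * \<alpha> + 3 * R t) * (deriv R t)^2
      + 8 * t * R t * (2 * real n + 1 + 2 * \<alpha> + R t) * deriv R t
      - (R t)^5
      - 2 * (2 * real n + 1 + 2 * \<alpha>) * (R t)^4
      - 4 * ((real n + \<alpha>) * (real n + 1 + \<alpha>) - t * (t - 2 * \<alpha>)) * (R t)^3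
      + 16 * t * (2 * real n + 1 + 2 * \<alpha>) * (t - \<alpha>) * (R t)^2
      + 4 * t * (2 * real n + 1 + 2 * \<alpha>)^2 * (5 * t - 2 * \<alpha>) * R t
      + 8 * t^2 * (2 * real n + 1 + 2 * \<alpha>)^3 = 0)
    \<and> twice_differentiable_pos r \<and>
    (\<forall>t>0.
      4 * t^2 * r t * (2 * t + r t) * deriv (deriv r) t
      - 4 * t^2 * (t + r t) * (deriv r t)^2
      + 4 * t * (r t)^2 * deriv r t
      - (r t)^5
      - (2 * real n + 2 * \<alpha> + 5 * t) * (r t)^4
      - 8 * t * (real n + \<alpha> + t) * (r t)^3
      - 4 * t * ((t + \<alpha>)^2 + real n * (2 * t + \<alpha>) - 1) * (r t)^2
      + 4 * (real n)^2 * t^2 * r t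
      + 4 * (real n)^2 * t^3 = 0)
    \<and> satisfies_painleve_V ((2 * real n + 1 + 2 * \<alpha>)^2 / 8) (- 1 / 8) \<alpha> (- 1 / 2) W"
proof -
  interpret orth_family \<alpha> P h
    using assms(1,2) by unfold_locales
  define c where "c = 2 * real n + 1 + 2 * \<alpha>"
  have c: "0 < c" using assms(1) by (simp add: c_def)
  \<comment> \<open>\<open>R1\<close> and \<open>r1\<close> solve the Riccati system for the first
    derivatives; \<open>R2\<close>, \<open>Y1\<close>, \<open>r2\<close> are these expressions
    differentiated formally. Second derivatives thus exist because first ones do.\<close>
  define R1 where "R1 t = ((R t)^2 + (c + 1) * R t - 2 * (r t + t) * (c + R t)) / (2 * t)" for t
  define Y where "Y t = r t * (r t + 2 * t) / R t" for t
  define r1 where "r1 t = (2 * r t + (c - 1) * r t + 2 * real n * t - r t * (r t + 2 * t) - 2 * c * Y t) / (2 * t)" for t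
  define R2 where "R2 t = (2 * R t * R1 t + (c + 1) * R1 t - 2 * (r1 t + 1) * (c + R t) - 2 * (r t + t) * R1 t - 2 * R1 t) / (2 * t)" for t
  define Y1 where "Y1 t = (2 * r t * r1 t + 2 * t * r1 t + 2 * r t - Y t * R1 t) / R t" for t
  define r2 where "r2 t = ((c - 1) * r1 t + 2 * real n - (2 * r t * r1 t + 2 * t * r1 t + 2 * r t) - 2 * c * Y1 t) / (2 * t)" for t
  have R_pos: "0 < R t" if "0 < t" for t
    using aux_R_pos[OF that] by (simp add: R_def)
  have r1_eq: "2 * t * R t * r1 t = R t * (2 * r t + (c - 1) * r t + 2 * real n * t - r t * (r t + 2 * t))
         - 2 * c * (r t * (r t + 2 * t))" if t: "0 < t" for t
  proof -
    have e: "2 * t * r1 t = 2 * r t + (c - 1) * r t + 2 * real n * t - r t * (r t + 2 * t) - 2 * c * Y t"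
      using t by (simp add: r1_def)
    have YR: "Y t * R t = r t * (r t + 2 * t)"
      using R_pos[OF t] by (simp add: Y_def)
    have "2 * t * R t * r1 t = R t * (2 * t * r1 t)" by simp
    then show ?thesis
      unfolding e YR[symmetric] by (simp add: algebra_simps)
  qed
  have dRr: "(R has_real_derivative R1 t) (at t) \<and> (r has_real_derivative r1 t) (at t)" if t: "0 < t" for t
  proof -
    obtain R' r' where *: "(R has_real_derivative R') (at t)" "(r has_real_derivative r') (at t)"
      "2 * t * R' = (R t)^2 + (c + 1) * R t - 2 * (r t + t) * (c + R t)"
      "2 * t * R t * r' = R t * (2 * r t + (c - 1) * r t + 2 * real n * t - r t * (r t + 2 * t))
         - 2 * c * (r t * (r t + 2 * t))"
      using riccati_system[OF t, of n] unfolding R_def r_def c_def by blast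
    have "R' = R1 t" using *(3) t by (simp add: R1_def field_simps)
    moreover have "r' = r1 t"
    proof -
      have "2 * t * R t * r' = 2 * t * R t * r1 t"
        unfolding *(4) r1_eq[OF t] ..
      then show ?thesis using t R_pos[OF t] by simp
    qed
    ultimately show ?thesis using * by simp
  qed
  then have dR: "(R has_real_derivative R1 t) (at t)" and dr: "(r has_real_derivative r1 t) (at t)"
    if "0 < t" for t using that by blast+
  have R2_eq: "2 * t * R2 t + 2 * R1 t = 2 * R t * R1 t + (c + 1) * R1 t
      - 2 * (r1 t + 1) * (c + R t) - 2 * (r t + t) * R1 t" if "0 < t" for t
    using that by (simp add: R2_def)
  have r2_eq: "2 * t * r2 t = (c - 1) * r1 t + 2 * real n
      - (2 * r t * r1 t + 2 * t * r1 t + 2 * r t) - 2 * c * Y1 t" if "0 < t" for t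
    using that by (simp add: r2_def)
  have dR1: "(R1 has_real_derivative R2 t) (at t)" if t: "0 < t" for t
  proof -
    \<comment> \<open>The numerator is \<open>2 * t * R1 t\<close>, so its derivative has the form
      on the right, and the quotient rule then isolates \<open>R2 t\<close>.\<close>
    have "((\<lambda>t. (R t)^2 + (c + 1) * R t - 2 * (r t + t) * (c + R t)) has_real_derivative
        2 * t * R2 t + 2 * R1 t) (at t)"
      unfolding R2_eq[OF t]
      by (auto intro!: derivative_eq_intros dR[OF t] dr[OF t] simp: algebra_simps)
    from DERIV_divide[OF this DERIV_cmult[OF DERIV_ident, of 2]] t show ?thesis
      unfolding R1_def[abs_def] by (auto elim!: DERIV_cong simp: field_simps)
  qed
  have dY: "(Y has_real_derivative Y1 t) (at t)" if t: "0 < t" for t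
    unfolding Y_def[abs_def] using R_pos[OF t] t
    by (auto intro!: derivative_eq_intros dR[OF t] dr[OF t] simp: Y1_def Y_def field_simps)
  have dr1: "(r1 has_real_derivative r2 t) (at t)" if t: "0 < t" for t
  proof -
    have "((\<lambda>t. 2 * r t + (c - 1) * r t + 2 * real n * t - r t * (r t + 2 * t) - 2 * c * Y t) has_real_derivative
        2 * t * r2 t + 2 * r1 t) (at t)"
      unfolding r2_eq[OF t]
      by (auto intro!: derivative_eq_intros dr[OF t] dY[OF t] simp: algebra_simps)
    from DERIV_divide[OF this DERIV_cmult[OF DERIV_ident, of 2]] t show ?thesis
      unfolding r1_def[abs_def] by (auto elim!: DERIV_cong simp: field_simps)
  qed
  have deriv_R: "deriv R t = R1 t" "deriv (deriv R) t = R2 t" if "0 < t" for t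
    using DERIV_imp_deriv[OF dR[OF that]] DERIV_imp_deriv[OF deriv_cong_pos[OF dR that dR1[OF that]]] by simp_all
  have deriv_r: "deriv r t = r1 t" "deriv (deriv r) t = r2 t" if "0 < t" for t
    using DERIV_imp_deriv[OF dr[OF that]] DERIV_imp_deriv[OF deriv_cong_pos[OF dr that dr1[OF that]]] by simp_all
  have W: "W = (\<lambda>t. (c + R t) / c)" by (simp add: W_def c_def)
  have dW: "(W has_real_derivative R1 t / c) (at t)" if "0 < t" for t
    unfolding W using c by (auto intro!: derivative_eq_intros dR[OF that])
  have dW1: "((\<lambda>t. R1 t / c) has_real_derivative R2 t / c) (at t)" if "0 < t" for t
    by (intro DERIV_cdivide dR1 that)
  have deriv_W: "deriv W t = R1 t / c" "deriv (deriv W) t = R2 t / c" if "0 < t" for t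
    using DERIV_imp_deriv[OF dW[OF that]] DERIV_imp_deriv[OF deriv_cong_pos[OF dW that dW1[OF that]]] by simp_all
  have R_ode: "8 * t^2 * R t * (2 * real n + 1 + 2 * \<alpha> + R t) * R2 t
      - 4 * t^2 * (4 * real n + 2 + 4 * \<alpha> + 3 * R t) * (R1 t)^2
      + 8 * t * R t * (2 * real n + 1 + 2 * \<alpha> + R t) * R1 t
      - (R t)^5
      - 2 * (2 * real n + 1 + 2 * \<alpha>) * (R t)^4
      - 4 * ((real n + \<alpha>) * (real n + 1 + \<alpha>) - t * (t - 2 * \<alpha>)) * (R t)^3
      + 16 * t * (2 * real n + 1 + 2 * \<alpha>) * (t - \<alpha>) * (R t)^2
      + 4 * t * (2 * real n + 1 + 2 * \<alpha>)^2 * (5 * t - 2 * \<alpha>) * R t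
      + 8 * t^2 * (2 * real n + 1 + 2 * \<alpha>)^3 = 0" if t: "0 < t" for t
  proof (rule riccati_to_R_ode[OF c_def])
    show "2 * t * R1 t = (R t)^2 + (c + 1) * R t - 2 * (r t + t) * (c + R t)"
      using t by (simp add: R1_def)
  qed (rule r1_eq[OF t], rule R2_eq[OF t])
  have r_ode: "4 * t^2 * r t * (2 * t + r t) * r2 t
      - 4 * t^2 * (t + r t) * (r1 t)^2
      + 4 * t * (r t)^2 * r1 t
      - (r t)^5
      - (2 * real n + 2 * \<alpha> + 5 * t) * (r t)^4
      - 8 * t * (real n + \<alpha> + t) * (r t)^3
      - 4 * t * ((t + \<alpha>)^2 + real n * (2 * t + \<alpha>) - 1) * (r t)^2
      + 4 * (real n)^2 * t^2 * r t
      + 4 * (real n)^2 * t^3 = 0" if t: "0 < t" for t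
  proof (rule riccati_to_r_ode[OF c_def])
    show "2 * t * R1 t = (R t)^2 + (c + 1) * R t - 2 * (r t + t) * (c + R t)"
      using t by (simp add: R1_def)
    show "Y t * R t = r t * (r t + 2 * t)" "R t \<noteq> 0"
      using R_pos[OF t] by (simp_all add: Y_def)
    show "2 * t * r1 t = 2 * r t + (c - 1) * r t + 2 * real n * t - r t * (r t + 2 * t) - 2 * c * Y t"
      using t by (simp add: r1_def)
    show "2 * t * r2 t = (c - 1) * r1 t + 2 * real n - (2 * r t * r1 t + 2 * t * r1 t + 2 * r t) - 2 * c * Y1 t"
      by (rule r2_eq[OF t])
    show "Y1 t * R t + Y t * R1 t = 2 * r t * r1 t + 2 * t * r1 t + 2 * r t"
      using R_pos[OF t] by (simp add: Y1_def)
  qed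
  have "satisfies_painleve_V (c^2 / 8) (- 1 / 8) \<alpha> (- 1 / 2) W"
    unfolding satisfies_painleve_V_def
  proof (intro conjI allI impI)
    show "twice_differentiable_pos W"
      by (rule twice_differentiable_posI[OF dW dW1])
    fix t :: real assume t: "0 < t"
    show "W t \<noteq> 0" "W t \<noteq> 1"
      using R_pos[OF t] c by (simp_all add: W)
    show "deriv (deriv W) t =
          (3 * W t - 1) * (deriv W t)\<^sup>2 / (2 * W t * (W t - 1)) - deriv W t / t
          + (W t - 1)\<^sup>2 / t\<^sup>2 * (c^2 / 8 * W t + (- 1 / 8) / W t) + \<alpha> * W t / t
          + (- 1 / 2) * W t * (W t + 1) / (W t - 1)"
      unfolding deriv_W[OF t] unfolding W
      by (rule R_ode_to_painleve[OF t R_pos[OF t] c c_def R_ode[OF t]])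
  qed
  then show ?thesis
    using twice_differentiable_posI[OF dR dR1] twice_differentiable_posI[OF dr dr1] R_ode r_ode
    unfolding c_def[symmetric] by (simp add: deriv_R deriv_r)
qed

end
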